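(* Let $X$ be an infinite, locally finite CW-complex of bounded degree, and let $k\ge 0$. Then the four probability measures $\mathbf P^{\mathrm W}_k$, $\mathbf P^{\mathrm F}_k$, $\mathbf P_{\mathrm W}^k$, $\mathbf P_{\mathrm F}^k$ on subsets of the set of $k$-cells of $X$ all coincide if and only if the reduced $k$th $\ell^2$-homology group $H^{(2)}_k(X)$ of $X$ vanishes.
   Context: All cells are oriented and all chains and cochains are cellular with complex coefficients. $\Xi_k X$ is the set of $k$-cells of $X$; $\partial_k$ is the cellular boundary map and $\delta_k=\partial_{k+1}^*$ the coboundary map. $C_k(X)$ is the space of finitely supported $k$-chains, regarded as a subspace of the Hilbert space $C^{(2)}_k(X)=\ell^2(\Xi_k X)$, in which the $k$-cells form an orthonormal basis; $k$-cochains are identified with $k$-chains through this inner product. $X$ has bounded degree if for every $k$ the map $\partial_k$ has bounded $\ell^2$-norm, so that it extends to a bounded operator $C^{(2)}_k(X)\to C^{(2)}_{k-1}(X)$. The reduced $k$th $\ell^2$-homology group is $H^{(2)}_k(X)=Z^{(2)}_k(X)/\overline{B^{(2)}_k(X)}$, where $Z^{(2)}_k(X)=\ker\partial_k$ on $C^{(2)}_k(X)$ and $B^{(2)}_k(X)=\partial_{k+1}C^{(2)}_{k+1}(X)$. Let $Z_k(X)=\{u\in C_k(X):\partial_k u=0\}$ and $B_k(X)=\partial_{k+1}C_{k+1}(X)$. Let $C^k_c(X)$ be the finitely supported $k$-cochains, $Z^k_c(X)=\{u\in C^k_c(X):\delta_k u=0\}$ and $B^k_c(X)=\delta_{k-1}C^{k-1}_c(X)$.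 Bars denote closure in $\ell^2(\Xi_kX)$ and $\perp$ denotes orthogonal complement there. For a countable set $E$ and a closed subspace $H\subseteq\ell^2(E)$ with orthogonal projection $P_H$ having matrix $Q_H$ in the standard basis, the determinantal probability measure $\mathbf P^H$ is the unique probability measure on subsets of $E$ such that a random set $\mathfrak F\sim \mathbf P^H$ satisfies $\mathbf P^H[D\subseteq\mathfrak F]=\det[Q_H]_{D,D}$ for all finite $D\subseteq E$. The measures $\mathbf P^{\mathrm W}_k,\mathbf P^{\mathrm F}_k,\mathbf P_{\mathrm W}^k,\mathbf P_{\mathrm F}^k$ are the determinantal measures on subsets of $\Xi_kX$ corresponding to the subspaces $\overline{B^k_c(X)}$, $Z_k(X)^\perp$, $\overline{Z^k_c(X)}$, $B_k(X)^\perp$, respectively. *)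

theory Defs
  imports
    "HOL-Probability.Probability"
    "HOL-Combinatorics.Permutations"
    "HOL-Algebra.Elementary_Groups"
    "HOL-Homology.Homology"
begin

section \<open>Oriented CW-complexes\<close>

definition cell_disc :: "nat \<Rightarrow> (nat \<Rightarrow> real) topology" where
  "cell_disc k = subtopology (Euclidean_space k) {x. (\<Sum>i<k. (x i)\<^sup>2) \<le> 1}"

definition cell_ball :: "nat \<Rightarrow> (nat \<Rightarrow> real) topology" where
  "cell_ball k = subtopology (Euclidean_space k) {x. (\<Sum>i<k. (x i)\<^sup>2) < 1}"

definition cell_sphere :: "nat \<Rightarrow> (nat \<Rightarrow> real) topology" where
  "cell_sphere k = subtopology (Euclidean_space k) {x. (\<Sum>i<k. (x i)\<^sup>2) = 1}"

text \<open>A cell is given by its dimension \<open>k\<close> and an index in \<open>cw_cells X k\<close>;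
  \<open>cw_map X k a\<close> is its characteristic map, and its orientation \<open>cw_orient X k a\<close> is one of
  the two generators of the infinite cyclic group \<open>H\<^sub>k(D\<^sup>k, S\<^sup>k\<^sup>-\<^sup>1)\<close>.\<close>

record ('a, 'c) oriented_cw =
  cw_space :: "'a topology"
  cw_cells :: "nat \<Rightarrow> 'c set"
  cw_map :: "nat \<Rightarrow> 'c \<Rightarrow> (nat \<Rightarrow> real) \<Rightarrow> 'a"
  cw_orient :: "nat \<Rightarrow> 'c \<Rightarrow> (nat \<Rightarrow> real) chain set"

definition all_cells :: "('a, 'c) oriented_cw \<Rightarrow> (nat \<times> 'c) set" where
  "all_cells X = (SIGMA k:UNIV. cw_cells X k)"

definition open_cell :: "('a, 'c) oriented_cw \<Rightarrow> nat \<Rightarrow> 'c \<Rightarrow> 'a set" where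
  "open_cell X k a = cw_map X k a ` topspace (cell_ball k)"

text \<open>The union of the cells of dimension strictly less than \<open>m\<close>, so that the
  \<open>k\<close>-skeleton is \<open>cw_below X (Suc k)\<close> and the \<open>(-1)\<close>-skeleton is \<open>cw_below X 0 = {}\<close>.\<close>

definition cw_below :: "('a, 'c) oriented_cw \<Rightarrow> nat \<Rightarrow> 'a set" where
  "cw_below X m = (\<Union>j<m. \<Union>a\<in>cw_cells X j. open_cell X j a)"

definition cell_generator :: "nat \<Rightarrow> (nat \<Rightarrow> real) chain set \<Rightarrow> bool" where
  "cell_generator k c \<longleftrightarrow>
     (let G = relative_homology_group (int k) (cell_disc k) (topspace (cell_sphere k))
      in c \<in> carrier G \<and> subgroup_generated G {c} = G)"

definition cw_complex :: "('a, 'c) oriented_cw \<Rightarrow> bool" where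
  "cw_complex X \<longleftrightarrow>
     Hausdorff_space (cw_space X) \<and>
     (\<forall>(k, a) \<in> all_cells X.
        continuous_map (cell_disc k) (cw_space X) (cw_map X k a) \<and>
        embedding_map (cell_ball k) (cw_space X) (cw_map X k a) \<and>
        cell_generator k (cw_orient X k a)) \<and>
     disjoint_family_on (\<lambda>(k, a). open_cell X k a) (all_cells X) \<and>
     (\<Union>(k, a) \<in> all_cells X. open_cell X k a) = topspace (cw_space X) \<and>
     \<comment> \<open>closure-finiteness\<close>
     (\<forall>(k, a) \<in> all_cells X.
        \<exists>F. finite F \<and> F \<subseteq> all_cells X \<and> (\<forall>(j, b) \<in> F. j < k) \<and>
          cw_map X k a ` topspace (cell_sphere k) \<subseteq> (\<Union>(j, b) \<in> F. open_cell X j b)) \<and>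
     \<comment> \<open>weak topology\<close>
     (\<forall>C \<subseteq> topspace (cw_space X).
        (\<forall>(k, a) \<in> all_cells X.
           closedin (cell_disc k) {x \<in> topspace (cell_disc k). cw_map X k a x \<in> C}) \<longrightarrow>
        closedin (cw_space X) C)"

definition cw_locally_finite :: "('a, 'c) oriented_cw \<Rightarrow> bool" where
  "cw_locally_finite X \<longleftrightarrow>
     locally_finite_in (cw_space X) ((\<lambda>(k, a). open_cell X k a) ` all_cells X)"


section \<open>The cellular boundary\<close>

text \<open>The integral cellular chain group \<open>H\<^sub>k(X\<^sup>k, X\<^sup>k\<^sup>-\<^sup>1)\<close>.\<close>

definition cellular_group :: "('a, 'c) oriented_cw \<Rightarrow> nat \<Rightarrow> 'a chain set monoid" where
  "cellular_group X k =
     relative_homology_group (int k) (subtopology (cw_space X) (cw_below X (Suc k))) (cw_below X k)"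

definition cell_class :: "('a, 'c) oriented_cw \<Rightarrow> nat \<Rightarrow> 'c \<Rightarrow> 'a chain set" where
  "cell_class X k a =
     hom_induced (int k) (cell_disc k) (topspace (cell_sphere k))
       (subtopology (cw_space X) (cw_below X (Suc k))) (cw_below X k)
       (cw_map X k a) (cw_orient X k a)"

text \<open>The composite
  \<open>H\<^sub>k\<^sub>+\<^sub>1(X\<^sup>k\<^sup>+\<^sup>1, X\<^sup>k) \<rightarrow> H\<^sub>k(X\<^sup>k) \<rightarrow> H\<^sub>k(X\<^sup>k, X\<^sup>k\<^sup>-\<^sup>1)\<close>.\<close>

definition cellular_boundary :: "('a, 'c) oriented_cw \<Rightarrow> nat \<Rightarrow> 'a chain set \<Rightarrow> 'a chain set" where
  "cellular_boundary X k c =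
     hom_induced (int k)
       (subtopology (cw_space X) (cw_below X (Suc k))) {}
       (subtopology (cw_space X) (cw_below X (Suc k))) (cw_below X k) id
       (hom_boundary (int (Suc k))
          (subtopology (cw_space X) (cw_below X (Suc (Suc k)))) (cw_below X (Suc k)) c)"

text \<open>\<open>n k a b\<close> is the incidence number of the \<open>(k+1)\<close>-cell \<open>a\<close> and the \<open>k\<close>-cell \<open>b\<close>, i.e.
  the coefficient of \<open>b\<close> in the cellular boundary of \<open>a\<close>.  Since the classes of the
  \<open>k\<close>-cells form a basis of the free abelian group \<open>H\<^sub>k(X\<^sup>k, X\<^sup>k\<^sup>-\<^sup>1)\<close>
  (written multiplicatively in the library), exactly one family of integers on the cells
  satisfies this condition.\<close>

definition incidence_numbers ::
    "('a, 'c) oriented_cw \<Rightarrow> (nat \<Rightarrow> 'c \<Rightarrow> 'c \<Rightarrow> int) \<Rightarrow> bool" where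
  "incidence_numbers X n \<longleftrightarrow>
     (\<forall>k. \<forall>a \<in> cw_cells X (Suc k).
        finite {b \<in> cw_cells X k. n k a b \<noteq> 0} \<and>
        cellular_boundary X k (cell_class X (Suc k) a) =
          (\<Otimes>\<^bsub>cellular_group X k\<^esub> b \<in> {b \<in> cw_cells X k. n k a b \<noteq> 0}.
             cell_class X k b [^]\<^bsub>cellular_group X k\<^esub> n k a b))"


section \<open>Square-summable functions\<close>

text \<open>\<open>\<ell>\<^sup>2(E)\<close> is represented by functions on the whole type that vanish off \<open>E\<close>.\<close>

definition l2 :: "'c set \<Rightarrow> ('c \<Rightarrow> complex) set" where
  "l2 E = {u. (\<forall>x. x \<notin> E \<longrightarrow> u x = 0) \<and> (\<lambda>x. (cmod (u x))\<^sup>2) summable_on UNIV}"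

definition l2_inner :: "('c \<Rightarrow> complex) \<Rightarrow> ('c \<Rightarrow> complex) \<Rightarrow> complex" where
  "l2_inner u v = (\<Sum>\<^sub>\<infinity>x. u x * cnj (v x))"

definition l2_norm :: "('c \<Rightarrow> complex) \<Rightarrow> real" where
  "l2_norm u = sqrt (\<Sum>\<^sub>\<infinity>x. (cmod (u x))\<^sup>2)"

definition l2_closure :: "'c set \<Rightarrow> ('c \<Rightarrow> complex) set \<Rightarrow> ('c \<Rightarrow> complex) set" where
  "l2_closure E S = {u \<in> l2 E. \<forall>\<epsilon>>0. \<exists>s\<in>S. l2_norm (\<lambda>x. u x - s x) < \<epsilon>}"

definition l2_perp :: "'c set \<Rightarrow> ('c \<Rightarrow> complex) set \<Rightarrow> ('c \<Rightarrow> complex) set" where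
  "l2_perp E S = {u \<in> l2 E. \<forall>s\<in>S. l2_inner u s = 0}"

definition l2_proj :: "'c set \<Rightarrow> ('c \<Rightarrow> complex) set \<Rightarrow> ('c \<Rightarrow> complex) \<Rightarrow> ('c \<Rightarrow> complex)" where
  "l2_proj E H u = (THE v. v \<in> H \<and> (\<lambda>x. u x - v x) \<in> l2_perp E H)"

definition proj_matrix :: "'c set \<Rightarrow> ('c \<Rightarrow> complex) set \<Rightarrow> 'c \<Rightarrow> 'c \<Rightarrow> complex" where
  "proj_matrix E H e f = l2_inner (l2_proj E H (\<lambda>x. of_bool (x = f))) (\<lambda>x. of_bool (x = e))"


section \<open>Determinantal probability measures\<close>

text \<open>The determinant of the finite matrix \<open>[Q]\<^sub>D\<^sub>,\<^sub>D\<close> by the Leibniz formula; the library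
  determinants are indexed by finite types or by initial segments of the natural numbers.\<close>

definition det_on :: "'c set \<Rightarrow> ('c \<Rightarrow> 'c \<Rightarrow> complex) \<Rightarrow> complex" where
  "det_on D Q = (\<Sum>p | p permutes D. of_int (sign p) * (\<Prod>e\<in>D. Q e (p e)))"

text \<open>The product \<open>\<sigma>\<close>-algebra on the subsets of \<open>E\<close>.\<close>

definition subset_algebra :: "'c set \<Rightarrow> 'c set measure" where
  "subset_algebra E = sigma (Pow E) {{F \<in> Pow E. e \<in> F} | e. e \<in> E}"

definition determinantal_measure ::
    "'c set \<Rightarrow> ('c \<Rightarrow> complex) set \<Rightarrow> 'c set measure \<Rightarrow> bool" where
  "determinantal_measure E H P \<longleftrightarrow>
     prob_space P \<and> sets P = sets (subset_algebra E) \<and>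
     (\<forall>D. finite D \<and> D \<subseteq> E \<longrightarrow>
        complex_of_real (measure P {F \<in> space P. D \<subseteq> F}) = det_on D (proj_matrix E H))"


section \<open>Cellular chains and cochains with complex coefficients\<close>

definition fin_chains :: "('a, 'c) oriented_cw \<Rightarrow> nat \<Rightarrow> ('c \<Rightarrow> complex) set" where
  "fin_chains X k = {u. finite {a. u a \<noteq> 0} \<and> {a. u a \<noteq> 0} \<subseteq> cw_cells X k}"

text \<open>The boundary map \<open>\<partial>\<^sub>k\<close>, with \<open>\<partial>\<^sub>0 = 0\<close>.  On finitely supported chains the sum is
  finite.  If \<open>\<partial>\<^sub>k\<^sub>+\<^sub>1\<close> is \<open>\<ell>\<^sup>2\<close>-bounded, the rows of its matrix are square-summable, so that
  the same formula gives its bounded extension to \<open>\<ell>\<^sup>2\<close>.\<close>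

primrec bd :: "('a, 'c) oriented_cw \<Rightarrow> (nat \<Rightarrow> 'c \<Rightarrow> 'c \<Rightarrow> int) \<Rightarrow> nat
    \<Rightarrow> ('c \<Rightarrow> complex) \<Rightarrow> ('c \<Rightarrow> complex)" where
  "bd X n 0 u = (\<lambda>_. 0)"
| "bd X n (Suc k) u =
     (\<lambda>b. if b \<in> cw_cells X k then \<Sum>\<^sub>\<infinity>a\<in>cw_cells X (Suc k). of_int (n k a b) * u a else 0)"

text \<open>The coboundary map \<open>\<delta>\<^sub>k\<close>, the adjoint of \<open>\<partial>\<^sub>k\<^sub>+\<^sub>1\<close>: its matrix is the transpose, the
  incidence numbers being real.\<close>

definition cobd :: "('a, 'c) oriented_cw \<Rightarrow> (nat \<Rightarrow> 'c \<Rightarrow> 'c \<Rightarrow> int) \<Rightarrow> nat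
    \<Rightarrow> ('c \<Rightarrow> complex) \<Rightarrow> ('c \<Rightarrow> complex)" where
  "cobd X n k u =
     (\<lambda>a. if a \<in> cw_cells X (Suc k) then \<Sum>\<^sub>\<infinity>b\<in>cw_cells X k. of_int (n k a b) * u b else 0)"

definition bounded_degree :: "('a, 'c) oriented_cw \<Rightarrow> (nat \<Rightarrow> 'c \<Rightarrow> 'c \<Rightarrow> int) \<Rightarrow> bool" where
  "bounded_degree X n \<longleftrightarrow>
     (\<forall>k. \<exists>C. \<forall>u \<in> fin_chains X k. l2_norm (bd X n k u) \<le> C * l2_norm u)"

definition fin_cycles :: "('a, 'c) oriented_cw \<Rightarrow> (nat \<Rightarrow> 'c \<Rightarrow> 'c \<Rightarrow> int) \<Rightarrow> nat
    \<Rightarrow> ('c \<Rightarrow> complex) set" where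
  "fin_cycles X n k = {u \<in> fin_chains X k. bd X n k u = (\<lambda>_. 0)}"

definition fin_boundaries :: "('a, 'c) oriented_cw \<Rightarrow> (nat \<Rightarrow> 'c \<Rightarrow> 'c \<Rightarrow> int) \<Rightarrow> nat
    \<Rightarrow> ('c \<Rightarrow> complex) set" where
  "fin_boundaries X n k = bd X n (Suc k) ` fin_chains X (Suc k)"

text \<open>Finitely supported cochains are identified with finitely supported chains.\<close>

definition fin_cocycles :: "('a, 'c) oriented_cw \<Rightarrow> (nat \<Rightarrow> 'c \<Rightarrow> 'c \<Rightarrow> int) \<Rightarrow> nat
    \<Rightarrow> ('c \<Rightarrow> complex) set" where
  "fin_cocycles X n k = {u \<in> fin_chains X k. cobd X n k u = (\<lambda>_. 0)}"

primrec fin_coboundaries :: "('a, 'c) oriented_cw \<Rightarrow> (nat \<Rightarrow> 'c \<Rightarrow> 'c \<Rightarrow> int) \<Rightarrow> nat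
    \<Rightarrow> ('c \<Rightarrow> complex) set" where
  "fin_coboundaries X n 0 = {\<lambda>_. 0}"
| "fin_coboundaries X n (Suc k) = cobd X n k ` fin_chains X k"

definition l2_cycles :: "('a, 'c) oriented_cw \<Rightarrow> (nat \<Rightarrow> 'c \<Rightarrow> 'c \<Rightarrow> int) \<Rightarrow> nat
    \<Rightarrow> ('c \<Rightarrow> complex) set" where
  "l2_cycles X n k = {u \<in> l2 (cw_cells X k). bd X n k u = (\<lambda>_. 0)}"

definition l2_boundaries :: "('a, 'c) oriented_cw \<Rightarrow> (nat \<Rightarrow> 'c \<Rightarrow> 'c \<Rightarrow> int) \<Rightarrow> nat
    \<Rightarrow> ('c \<Rightarrow> complex) set" where
  "l2_boundaries X n k = bd X n (Suc k) ` l2 (cw_cells X (Suc k))"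

definition l2_homology :: "('a, 'c) oriented_cw \<Rightarrow> (nat \<Rightarrow> 'c \<Rightarrow> 'c \<Rightarrow> int) \<Rightarrow> nat
    \<Rightarrow> ('c \<Rightarrow> complex) set monoid" where
  "l2_homology X n k =
     \<lparr>carrier = l2_cycles X n k, mult = (\<lambda>u v x. u x + v x), one = (\<lambda>_. 0)\<rparr>
       Mod l2_closure (cw_cells X k) (l2_boundaries X n k)"


section \<open>The four measures on sets of cells\<close>

definition lower_wired :: "('a, 'c) oriented_cw \<Rightarrow> (nat \<Rightarrow> 'c \<Rightarrow> 'c \<Rightarrow> int) \<Rightarrow> nat
    \<Rightarrow> 'c set measure \<Rightarrow> bool" where
  "lower_wired X n k = determinantal_measure (cw_cells X k)
     (l2_closure (cw_cells X k) (fin_coboundaries X n k))"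

definition lower_free :: "('a, 'c) oriented_cw \<Rightarrow> (nat \<Rightarrow> 'c \<Rightarrow> 'c \<Rightarrow> int) \<Rightarrow> nat
    \<Rightarrow> 'c set measure \<Rightarrow> bool" where
  "lower_free X n k = determinantal_measure (cw_cells X k)
     (l2_perp (cw_cells X k) (fin_cycles X n k))"

definition upper_wired :: "('a, 'c) oriented_cw \<Rightarrow> (nat \<Rightarrow> 'c \<Rightarrow> 'c \<Rightarrow> int) \<Rightarrow> nat
    \<Rightarrow> 'c set measure \<Rightarrow> bool" where
  "upper_wired X n k = determinantal_measure (cw_cells X k)
     (l2_closure (cw_cells X k) (fin_cocycles X n k))"

definition upper_free :: "('a, 'c) oriented_cw \<Rightarrow> (nat \<Rightarrow> 'c \<Rightarrow> 'c \<Rightarrow> int) \<Rightarrow> nat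
    \<Rightarrow> 'c set measure \<Rightarrow> bool" where
  "upper_free X n k = determinantal_measure (cw_cells X k)
     (l2_perp (cw_cells X k) (fin_boundaries X n k))"

end

theory Submission
  imports Defs
begin

text \<open>Write \<open>H\<^sub>1 = cl B\<^sup>k\<^sub>c\<close>, \<open>H\<^sub>2 = Z\<^sub>k\<^sup>\<bottom>\<close>, \<open>H\<^sub>3 = cl Z\<^sup>k\<^sub>c\<close> and \<open>H\<^sub>4 = B\<^sub>k\<^sup>\<bottom>\<close>.
  Since \<open>\<partial>\<partial> = 0\<close> and \<open>\<delta>\<close> is adjoint to \<open>\<partial>\<close>, both \<open>H\<^sub>2\<close> and \<open>H\<^sub>3\<close> lie between \<open>H\<^sub>1\<close> and \<open>H\<^sub>4\<close>.
  The one-point probabilities are the diagonal entries of the projections, so that for nested subspaces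
  the measures coincide only if the subspaces do; hence the four measures agree iff \<open>H\<^sub>1 = H\<^sub>4\<close>.
  Finally \<open>H\<^sub>1\<^sup>\<bottom>\<close> is the space of \<open>\<ell>\<^sup>2\<close>-cycles and \<open>H\<^sub>4\<^sup>\<bottom>\<close> is the closure of the \<open>\<ell>\<^sup>2\<close>-boundaries.

  That \<open>\<partial>\<partial> = 0\<close> holds for the incidence numbers requires the classes of the cells to be linearly independent
  in the cellular chain group. The coefficient of a cell \<open>c\<close> is detected in the local homology at
  its center: excision identifies it with that of the disc, and the other cells miss the center.\<close>

section \<open>Discs and spheres\<close>


text \<open>Only the independence of the cell classes is needed, not that they generate, and for
  this local homology suffices: evaluated at the center of one cell,
  \<open>\<partial>\<partial>\<close> becomes a power of a single element of infinite order. The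
  excision behind this requires an open k-cell to be open in the k-skeleton, which is drawn from
  local finiteness. On the analytic side the obstacle is that \<open>infsum\<close> takes the value
  0 on divergent sums, so the formulas for \<open>\<partial>\<close> and \<open>\<delta>\<close>
  have to be known to be finite sums. Incidence numbers are integers; hence boundedness of the
  boundary operator forces every cell to have only finitely many nonzero incidences, upwards as well
  as downwards. Both operators then preserve finite support, and adjointness is an interchange of
  finite sums. Boundedness enters a second time only to compare the closures of the finitely
  supported and of the square-summable boundaries. The two intermediate subspaces are never compared
  with each other: each is squeezed between the extreme ones.\<close>

lemma cell_disc_eq_top_of_set:
  "cell_disc k = top_of_set {x. (\<forall>i\<ge>k. x i = 0) \<and> (\<Sum>i<k. (x i)\<^sup>2) \<le> 1}"
  by (simp add: cell_disc_def Euclidean_space_def euclidean_product_topology subtopology_subtopology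
      Collect_conj_eq)

lemma topspace_cell_disc:
  "topspace (cell_disc k) = {x. (\<forall>i\<ge>k. x i = 0) \<and> (\<Sum>i<k. (x i)\<^sup>2) \<le> 1}"
  by (simp add: cell_disc_eq_top_of_set)

lemma topspace_cell_ball:
  "topspace (cell_ball k) = {x. (\<forall>i\<ge>k. x i = 0) \<and> (\<Sum>i<k. (x i)\<^sup>2) < 1}"
  by (auto simp: cell_ball_def topspace_Euclidean_space)

lemma topspace_cell_sphere:
  "topspace (cell_sphere k) = {x. (\<forall>i\<ge>k. x i = 0) \<and> (\<Sum>i<k. (x i)\<^sup>2) = 1}"
  by (auto simp: cell_sphere_def topspace_Euclidean_space)

lemma topspace_cell_disc_Un: "topspace (cell_disc k) = topspace (cell_ball k) \<union> topspace (cell_sphere k)"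
  by (auto simp: topspace_cell_disc topspace_cell_ball topspace_cell_sphere)

lemma cell_ball_Int_cell_sphere: "topspace (cell_ball k) \<inter> topspace (cell_sphere k) = {}"
  by (auto simp: topspace_cell_ball topspace_cell_sphere)

text \<open>Excising the sphere leaves a subtopology of the disc, which has to be recognized as the
  space on which characteristic maps are embeddings.\<close>

lemma cell_ball_eq_subtopology_disc: "cell_ball k = subtopology (cell_disc k) (topspace (cell_ball k))"
proof -
  have "topspace (Euclidean_space k) \<inter> ({x. (\<Sum>i<k. (x i)\<^sup>2) \<le> 1} \<inter> topspace (cell_ball k)) =
      topspace (Euclidean_space k) \<inter> {x. (\<Sum>i<k. (x i)\<^sup>2) < 1}"
    by (auto simp: topspace_cell_ball topspace_Euclidean_space)
  then show ?thesis
    unfolding cell_disc_def subtopology_subtopology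
    by (metis cell_ball_def subtopology_restrict)
qed

lemma cell_sphere_eq_subtopology_disc:
  "cell_sphere k = subtopology (cell_disc k) (topspace (cell_sphere k))"
proof -
  have "topspace (Euclidean_space k) \<inter> ({x. (\<Sum>i<k. (x i)\<^sup>2) \<le> 1} \<inter> topspace (cell_sphere k)) =
      topspace (Euclidean_space k) \<inter> {x. (\<Sum>i<k. (x i)\<^sup>2) = 1}"
    by (auto simp: topspace_cell_sphere topspace_Euclidean_space)
  then show ?thesis
    unfolding cell_disc_def subtopology_subtopology
    by (metis cell_sphere_def subtopology_restrict)
qed

text \<open>Index shift: \<open>cell_sphere k\<close> is the (k-1)-sphere, whereas
  \<open>nsphere k\<close> is the k-sphere with coordinates \<open>0..k\<close>.\<close>

lemma cell_sphere_Suc: "cell_sphere (Suc k) = nsphere k"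
  by (simp add: cell_sphere_def nsphere_def lessThan_Suc_atMost)

section \<open>Point-set topology of the disc\<close>

lemma continuous_on_sum_squares: "continuous_on A (\<lambda>x::nat \<Rightarrow> real. \<Sum>i<k. (x i)\<^sup>2)"
  by (intro continuous_intros continuous_on_subset [OF continuous_on_product_coordinates]) auto

lemma zero_in_cell_ball: "(\<lambda>_. 0) \<in> topspace (cell_ball k)"
  by (simp add: topspace_cell_ball)

lemma closedin_cell_sphere: "closedin (cell_disc k) (topspace (cell_sphere k))"
proof -
  have "closedin (cell_disc k) {x \<in> topspace (cell_disc k). (\<Sum>i<k. (x i)\<^sup>2) \<in> {1}}"
    by (rule closedin_continuous_map_preimage [where Y = euclideanreal])
      (simp_all add: cell_disc_eq_top_of_set continuous_on_sum_squares)
  moreover have "{x \<in> topspace (cell_disc k). (\<Sum>i<k. (x i)\<^sup>2) \<in> {1}} = topspace (cell_sphere k)"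
    by (auto simp: topspace_cell_sphere topspace_cell_disc)
  ultimately show ?thesis by simp
qed

lemma sum_squares_eq_0_iff:
  fixes x :: "nat \<Rightarrow> real"
  assumes "\<forall>i\<ge>k. x i = 0"
  shows "(\<Sum>i<k. (x i)\<^sup>2) = 0 \<longleftrightarrow> x = (\<lambda>_. 0)"
proof
  assume "(\<Sum>i<k. (x i)\<^sup>2) = 0"
  then have "x i = 0" if "i < k" for i
    using that by (simp add: sum_nonneg_eq_0_iff)
  with assms show "x = (\<lambda>_. 0)"
    by (metis leI)
qed simp

text \<open>Every coordinate is bounded by the sum of squares, so the disc is a closed subset of a
  product of copies of \<open>{-1..1}\<close>, which is compact by Tychonoff.\<close>

lemma compact_cell_disc: "compact_space (cell_disc k)"
proof -
  let ?D = "{x::nat \<Rightarrow> real. (\<forall>i\<ge>k. x i = 0) \<and> (\<Sum>i<k. (x i)\<^sup>2) \<le> 1}"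
  have "compactin (powertop_real UNIV) (PiE UNIV (\<lambda>_. {-1..1::real}))"
    by (subst compactin_PiE) auto
  then have "compact (PiE UNIV (\<lambda>_::nat. {-1..1::real}))"
    by (simp add: euclidean_product_topology)
  moreover have "closed ?D"
    unfolding Collect_conj_eq Collect_all_eq Collect_imp_eq
    by (intro closed_Int closed_INT ballI closed_Collect_le closed_Un closed_Collect_eq
        continuous_on_sum_squares continuous_on_const continuous_on_product_coordinates) auto
  moreover have "?D \<subseteq> PiE UNIV (\<lambda>_::nat. {-1..1::real})"
  proof (clarsimp simp: PiE_def Pi_def)
    fix x :: "nat \<Rightarrow> real" and i
    assume x: "\<forall>i\<ge>k. x i = 0" "(\<Sum>i<k. (x i)\<^sup>2) \<le> 1"
    have "(x i)\<^sup>2 \<le> 1"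
    proof (cases "i < k")
      case True
      then have "(x i)\<^sup>2 \<le> (\<Sum>i<k. (x i)\<^sup>2)" by (intro member_le_sum) auto
      then show ?thesis using x by linarith
    qed (use x in auto)
    then show "-1 \<le> x i \<and> x i \<le> 1"
      by (simp add: abs_le_iff abs_square_le_1 minus_le_iff)
  qed
  ultimately have "compact ?D"
    using compact_Int_closed [of "PiE UNIV (\<lambda>_::nat. {-1..1::real})" ?D] by (simp add: Int_absorb1)
  then show ?thesis
    by (simp add: cell_disc_eq_top_of_set compact_space_subtopology)
qed

lemma contractible_cell_disc: "contractible_space (cell_disc k)"
proof -
  let ?D = "{x::nat \<Rightarrow> real. (\<forall>i\<ge>k. x i = 0) \<and> (\<Sum>i<k. (x i)\<^sup>2) \<le> 1}"
  have "homotopic_with_canon (\<lambda>x. True) ?D ?D (\<lambda>x. x) (\<lambda>_ _. 0)"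
  unfolding homotopic_with_def
  proof (intro exI conjI)
    \<comment> \<open>The straight-line contraction to the center; it multiplies the sum of squares
      by \<open>(1 - t)\<^sup>2\<close>.\<close>
    let ?h = "\<lambda>(t, x) i. (1 - t) * x i :: real"
    have "continuous_on ({0..1} \<times> ?D) (\<lambda>p. ?h p i)" for i
      unfolding case_prod_unfold
      by (intro continuous_intros continuous_on_compose2 [OF continuous_on_product_coordinates continuous_on_snd]) auto
    then have "continuous_on ({0..1} \<times> ?D) ?h"
      by (rule continuous_on_coordinatewise_then_product)
    moreover have "(\<Sum>i<k. ((1 - t) * x i)\<^sup>2) \<le> 1"
      if "0 \<le> t" "t \<le> 1" "(\<Sum>i<k. (x i)\<^sup>2) \<le> 1" for t and x :: "nat \<Rightarrow> real"
    proof -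
      have "(\<Sum>i<k. ((1 - t) * x i)\<^sup>2) = (1 - t)\<^sup>2 * (\<Sum>i<k. (x i)\<^sup>2)"
        by (simp add: power_mult_distrib sum_distrib_left)
      also have "\<dots> \<le> 1 * 1"
        using that by (intro mult_mono) (auto simp: abs_square_le_1 sum_nonneg)
      finally show ?thesis by simp
    qed
    ultimately show "continuous_map (prod_topology (top_of_set {0..1}) (top_of_set ?D)) (top_of_set ?D) ?h"
      by (auto simp: case_prod_unfold)
  qed (simp_all add: fun_eq_iff)
  then show ?thesis
    unfolding contractible_space_def cell_disc_eq_top_of_set id_def by blast
qed

text \<open>The retraction is radial projection. For \<open>k = 0\<close> both sets are
  empty.\<close>

lemma retract_cell_sphere:
  "topspace (cell_sphere k) retract_of_space
     subtopology (cell_disc k) (topspace (cell_disc k) - {\<lambda>_. 0})"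
proof -
  let ?P = "topspace (cell_disc k) - {\<lambda>_. 0}"
  let ?r = "\<lambda>x i. x i / sqrt (\<Sum>i<k. (x i)\<^sup>2) :: real"
  have pos: "(\<Sum>i<k. (x i)\<^sup>2) > 0" if "x \<in> ?P" for x
    using that sum_squares_eq_0_iff [of k x]
    by (auto simp: topspace_cell_disc sum_nonneg order_less_le)
  have "continuous_on ?P (\<lambda>x. ?r x i)" for i
    using pos [THEN less_imp_neq]
    by (intro continuous_intros continuous_on_subset [OF continuous_on_product_coordinates]
        continuous_on_sum_squares) auto
  then have "continuous_on ?P ?r"
    by (rule continuous_on_coordinatewise_then_product)
  moreover have r: "?r x \<in> topspace (cell_sphere k)" if "x \<in> ?P" for x
    using pos [OF that] that
    by (auto simp: topspace_cell_sphere topspace_cell_disc power_divide simp flip: sum_divide_distrib)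
  moreover have sub: "topspace (cell_sphere k) \<subseteq> ?P"
    by (auto simp: topspace_cell_sphere topspace_cell_disc)
  moreover have eq: "subtopology (cell_disc k) A = top_of_set A" if "A \<subseteq> topspace (cell_disc k)" for A
    using that by (auto simp: cell_disc_eq_top_of_set subtopology_subtopology Int_absorb1)
  ultimately have cont: "continuous_map (top_of_set ?P) (top_of_set (topspace (cell_sphere k))) ?r"
    unfolding continuous_map_subtopology_eu by blast
  have top: "subtopology (cell_disc k) ?P = top_of_set ?P"
    "subtopology (top_of_set ?P) (topspace (cell_sphere k)) = top_of_set (topspace (cell_sphere k))"
    by (simp_all only: eq [OF Diff_subset] subtopology_subtopology Int_absorb1 [OF sub])
  have "continuous_map (subtopology (cell_disc k) ?P)
      (subtopology (subtopology (cell_disc k) ?P) (topspace (cell_sphere k))) ?r"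
    unfolding top by (fact cont)
  moreover have "\<forall>x\<in>topspace (cell_sphere k). ?r x = x"
    by (auto simp: topspace_cell_sphere)
  moreover have "topspace (cell_sphere k) \<subseteq> topspace (subtopology (cell_disc k) ?P)"
    using sub by auto
  ultimately show ?thesis
    unfolding retract_of_space_def by blast
qed

text \<open>By naturality, this map followed by the connecting map equals the connecting map
  followed by the inclusion of the sphere into the punctured disc. The connecting map is injective
  since the disc is contractible, the inclusion since the sphere is a retract. The connecting
  argument needs a nonempty sphere; in dimension 0 the map is the identity.\<close>

lemma inj_on_disc_sphere_to_punctured_disc:
  "inj_on (hom_induced (int k) (cell_disc k) (topspace (cell_sphere k))
             (cell_disc k) (topspace (cell_disc k) - {\<lambda>_. 0}) id)
     (carrier (relative_homology_group (int k) (cell_disc k) (topspace (cell_sphere k))))"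
    (is "inj_on ?h (carrier ?G)")
proof (cases k)
  case 0
  then have "topspace (cell_sphere k) = {}" "topspace (cell_disc k) - {\<lambda>_. 0} = {}"
    by (auto simp: topspace_cell_sphere topspace_cell_disc)
  then show ?thesis
    by (auto simp only: hom_induced_id id_apply intro!: inj_on_inverseI [where g = id])
next
  case (Suc p)
  let ?S = "topspace (cell_sphere k)" and ?P = "topspace (cell_disc k) - {\<lambda>_. 0}"
  have sub: "?S \<subseteq> ?P"
    by (auto simp: topspace_cell_sphere topspace_cell_disc)
  have "?S \<noteq> {}"
    using nonempty_nsphere [of p] Suc by (simp add: cell_sphere_Suc)
  then have ne: "topspace (cell_disc k) \<inter> ?S \<noteq> {}"
    using sub by blast
  have 1: "inj_on (hom_boundary (int k) (cell_disc k) ?S) (carrier ?G)"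
    using iso_relative_homology_of_contractible [OF contractible_cell_disc ne]
    by (simp add: iso_iff)
  have 2: "inj_on (hom_induced (int k - 1) (subtopology (cell_disc k) ?S) {} (subtopology (cell_disc k) ?P) {} id)
     (carrier (homology_group (int k - 1) (subtopology (cell_disc k) ?S)))"
    using inj_on_hom_induced_inclusion [OF disjI2, OF retract_cell_sphere [of k], of "int k - 1"]
    unfolding subtopology_subtopology using sub by (simp add: Int_absorb1)
  have "hom_boundary (int k) (cell_disc k) ?P \<circ> ?h =
      hom_induced (int k - 1) (subtopology (cell_disc k) ?S) {} (subtopology (cell_disc k) ?P) {} id \<circ>
        hom_boundary (int k) (cell_disc k) ?S"
    using sub by (intro naturality_hom_induced) auto
  moreover have "inj_on \<dots> (carrier ?G)"
    by (rule comp_inj_on [OF 1 inj_on_subset [OF 2]]) (auto simp: hom_boundary_carrier)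
  ultimately have "inj_on (hom_boundary (int k) (cell_disc k) ?P \<circ> ?h) (carrier ?G)"
    by simp
  then show ?thesis
    by (rule inj_on_imageI2)
qed

text \<open>For \<open>k > 0\<close> the connecting map identifies the group with the reduced
  homology of the (k-1)-sphere; for \<open>k = 0\<close> it is the zeroth homology of a
  path-connected space.\<close>

lemma isomorphic_disc_sphere_integer_group:
  "relative_homology_group (int k) (cell_disc k) (topspace (cell_sphere k)) \<cong> integer_group"
proof (cases k)
  case 0
  have "topspace (cell_sphere k) = {}"
    using 0 by (auto simp: topspace_cell_sphere)
  moreover have "topspace (cell_disc k) \<noteq> {}"
    using zero_in_cell_ball [of k] topspace_cell_disc_Un [of k] by blast
  ultimately show ?thesis
    using isomorphic_integer_zeroth_homology_group [of "cell_disc k"] 0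
    by (simp add: contractible_cell_disc contractible_imp_path_connected_space)
next
  case (Suc p)
  have "topspace (cell_sphere k) \<noteq> {}"
    using nonempty_nsphere [of p] Suc by (simp add: cell_sphere_Suc)
  then have "topspace (cell_disc k) \<inter> topspace (cell_sphere k) \<noteq> {}"
    by (auto simp: topspace_cell_disc_Un)
  from isomorphic_group_relative_homology_of_contractible [OF contractible_cell_disc this, of "int k"]
  have "relative_homology_group (int k) (cell_disc k) (topspace (cell_sphere k)) \<cong>
      reduced_homology_group (int p) (nsphere p)"
    using Suc cell_sphere_eq_subtopology_disc [of k] by (simp add: cell_sphere_Suc)
  then show ?thesis
    using reduced_homology_group_nsphere(1) iso_trans by blast
qed

text \<open>Some power of the generator corresponds to the integer 1, so the generator itself
  corresponds to a nonzero integer.\<close>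

lemma generator_of_infinite_cyclic_torsion_free:
  fixes m :: int
  assumes "group G" "G \<cong> integer_group" "c \<in> carrier G" "subgroup_generated G {c} = G"
    "c [^]\<^bsub>G\<^esub> m = \<one>\<^bsub>G\<^esub>"
  shows "m = 0"
proof -
  interpret group G by fact
  obtain f where f: "f \<in> iso G integer_group"
    using assms by (auto simp: is_iso_def)
  then have hom: "f \<in> hom G integer_group" and surj: "f ` carrier G = UNIV"
    by (auto simp: iso_iff)
  have pow: "f (c [^]\<^bsub>G\<^esub> j) = j * f c" for j :: int
    using hom_int_pow [OF hom assms(3,1) group_integer_group, of j] by simp
  have "carrier G = range (\<lambda>j::int. c [^]\<^bsub>G\<^esub> j)"
    using carrier_subgroup_generated_by_singleton [OF assms(3)] assms(4) by simp
  then obtain j :: int where "f (c [^]\<^bsub>G\<^esub> j) = 1"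
    using surj by (metis (no_types, lifting) UNIV_I imageE)
  then have "f c \<noteq> 0"
    using pow by auto
  moreover have "m * f c = 0"
    using pow [of m] assms hom_one [OF hom] by simp
  ultimately show ?thesis by simp
qed

lemma cell_generator_torsion_free:
  fixes m :: int
  assumes "cell_generator k c"
    and "c [^]\<^bsub>relative_homology_group (int k) (cell_disc k) (topspace (cell_sphere k))\<^esub> m =
      \<one>\<^bsub>relative_homology_group (int k) (cell_disc k) (topspace (cell_sphere k))\<^esub>"
  shows "m = 0"
  using assms generator_of_infinite_cyclic_torsion_free [OF _ isomorphic_disc_sphere_integer_group, of k c m]
  by (auto simp: cell_generator_def Let_def)

text \<open>With p the image of the center, enlarging the sphere to the punctured disc is injective.
  Excising the sphere then reduces the disc to the open ball, the embedding carries the ball to the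
  open cell, and excising the complement of the cell reaches \<open>Y\<close> modulo
  \<open>Y - p\<close>. Openness of the cell makes the second excision legitimate; disjointness of
  the images of sphere and ball keeps the punctured disc away from p.\<close>

lemma inj_on_hom_induced_punctured:
  assumes haus: "Hausdorff_space Y"
    and cont: "continuous_map (cell_disc k) Y f"
    and emb: "embedding_map (cell_ball k) Y f"
    and opn: "openin Y (f ` topspace (cell_ball k))"
    and disj: "f ` topspace (cell_sphere k) \<inter> f ` topspace (cell_ball k) = {}"
  shows "inj_on (hom_induced (int k) (cell_disc k) (topspace (cell_sphere k))
             Y (topspace Y - {f (\<lambda>_. 0)}) f)
     (carrier (relative_homology_group (int k) (cell_disc k) (topspace (cell_sphere k))))"
proof -
  let ?D = "cell_disc k" and ?B = "cell_ball k" and ?S = "topspace (cell_sphere k)"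
  let ?z = "(\<lambda>_. 0) :: nat \<Rightarrow> real"
  let ?e = "f ` topspace ?B" and ?p = "f ?z"
  let ?PD = "topspace ?D - {?z}" and ?PB = "topspace ?B - {?z}" and ?PY = "topspace Y - {?p}"
  have z: "?z \<in> topspace ?B"
    by (rule zero_in_cell_ball)
  have BD: "topspace ?B \<subseteq> topspace ?D" and D_minus: "topspace ?D - ?S = topspace ?B"
    and PD_minus: "?PD - ?S = ?PB" and SPD: "?S \<subseteq> ?PD"
    using topspace_cell_disc_Un [of k] cell_ball_Int_cell_sphere [of k] z by auto
  have inj: "inj_on f (topspace ?B)"
    using emb by (simp add: embedding_map_def homeomorphic_imp_injective_map)
  have fY: "f ` topspace ?D \<subseteq> topspace Y"
    using cont by (simp add: continuous_map_image_subset_topspace)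
  have eY: "?e \<subseteq> topspace Y" and pe: "?p \<in> ?e"
    using fY BD z by auto
  have f_PD: "f \<in> ?PD \<rightarrow> ?PY"
  proof
    fix x assume x: "x \<in> ?PD"
    then have "f x \<noteq> ?p"
      using disj inj z topspace_cell_disc_Un [of k] by (auto simp: inj_on_def)
    then show "f x \<in> ?PY"
      using x fY by auto
  qed
  have "openin ?D ?PD"
  proof -
    have "Hausdorff_space ?D"
      by (simp add: cell_disc_def Hausdorff_space_subtopology Hausdorff_Euclidean_space)
    then show ?thesis
      using closedin_Hausdorff_singleton [of ?D ?z] z BD by (auto intro: openin_diff)
  qed
  then have excD: "hom_induced (int k) ?B ?PB ?D ?PD id
      \<in> iso (relative_homology_group (int k) ?B ?PB) (relative_homology_group (int k) ?D ?PD)"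
    using homology_excision_axiom [of ?D ?S ?PD "topspace ?D" "int k"] SPD
    by (simp add: D_minus PD_minus closure_of_closedin closedin_cell_sphere interior_of_openin
        flip: cell_ball_eq_subtopology_disc)
  have "openin Y ?PY"
    using closedin_Hausdorff_singleton [OF haus] pe eY by (auto intro: openin_diff)
  moreover have "closedin Y (topspace Y - ?e)"
    using opn by (simp add: closedin_diff)
  moreover have "topspace Y - (topspace Y - ?e) = ?e" "?PY - (topspace Y - ?e) = ?e - {?p}"
    using eY by auto
  ultimately have excY: "hom_induced (int k) (subtopology Y ?e) (?e - {?p}) Y ?PY id
      \<in> iso (relative_homology_group (int k) (subtopology Y ?e) (?e - {?p}))
            (relative_homology_group (int k) Y ?PY)"
    using homology_excision_axiom [of Y "topspace Y - ?e" ?PY "topspace Y" "int k"] pe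
    by (auto simp: closure_of_closedin interior_of_openin)
  have homeo: "homeomorphic_map ?B (subtopology Y ?e) f"
    using emb by (simp add: embedding_map_def)
  have f_PB: "f ` ?PB = ?e - {?p}"
    using inj z by (auto simp: inj_on_def)
  have iso_f: "hom_induced (int k) ?B ?PB (subtopology Y ?e) (?e - {?p}) f
      \<in> iso (relative_homology_group (int k) ?B ?PB)
            (relative_homology_group (int k) (subtopology Y ?e) (?e - {?p}))"
    using homeomorphic_map_relative_homology_iso [OF homeo _ f_PB] by auto
  have contB: "continuous_map ?B ?D id" "continuous_map ?B (subtopology Y ?e) f"
    using homeo homeomorphic_imp_continuous_map cell_ball_eq_subtopology_disc [of k]
    by (metis continuous_map_from_subtopology continuous_map_id, metis)
  have square: "hom_induced (int k) ?D ?PD Y ?PY f \<circ> hom_induced (int k) ?B ?PB ?D ?PD id =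
      hom_induced (int k) (subtopology Y ?e) (?e - {?p}) Y ?PY id \<circ>
        hom_induced (int k) ?B ?PB (subtopology Y ?e) (?e - {?p}) f"
  proof -
    have "hom_induced (int k) ?D ?PD Y ?PY f \<circ> hom_induced (int k) ?B ?PB ?D ?PD id =
        hom_induced (int k) ?B ?PB Y ?PY (f \<circ> id)"
      using contB cont f_PD BD by (intro hom_induced_compose [symmetric]) auto
    moreover have "hom_induced (int k) (subtopology Y ?e) (?e - {?p}) Y ?PY id \<circ>
        hom_induced (int k) ?B ?PB (subtopology Y ?e) (?e - {?p}) f =
        hom_induced (int k) ?B ?PB Y ?PY (id \<circ> f)"
      using contB f_PB eY by (intro hom_induced_compose [symmetric]) auto
    ultimately show ?thesis by simp
  qed
  have "inj_on (hom_induced (int k) (subtopology Y ?e) (?e - {?p}) Y ?PY id \<circ>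
      hom_induced (int k) ?B ?PB (subtopology Y ?e) (?e - {?p}) f)
      (carrier (relative_homology_group (int k) ?B ?PB))"
    using excY iso_f by (intro comp_inj_on) (auto simp: iso_iff)
  then have "inj_on (hom_induced (int k) ?D ?PD Y ?PY f)
      (hom_induced (int k) ?B ?PB ?D ?PD id ` carrier (relative_homology_group (int k) ?B ?PB))"
    using square by (metis inj_on_imageI)
  \<comment> \<open>Excision is also surjective, so the image on which injectivity is known is the
    whole group.\<close>
  then have "inj_on (hom_induced (int k) ?D ?PD Y ?PY f)
      (carrier (relative_homology_group (int k) ?D ?PD))"
    using excD by (simp add: iso_iff)
  then have "inj_on (hom_induced (int k) ?D ?PD Y ?PY f \<circ> hom_induced (int k) ?D ?S ?D ?PD id)
      (carrier (relative_homology_group (int k) ?D ?S))"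
    by (intro comp_inj_on inj_on_disc_sphere_to_punctured_disc)
      (auto elim!: inj_on_subset simp: hom_induced_carrier)
  moreover have "hom_induced (int k) ?D ?PD Y ?PY f \<circ> hom_induced (int k) ?D ?S ?D ?PD id =
      hom_induced (int k) ?D ?S Y ?PY (f \<circ> id)"
    using cont f_PD SPD by (intro hom_induced_compose [symmetric]) auto
  ultimately show ?thesis by simp
qed

section \<open>Skeleta of a locally finite complex\<close>

definition skeleton :: "('a, 'c) oriented_cw \<Rightarrow> nat \<Rightarrow> 'a topology" where
  "skeleton X k = subtopology (cw_space X) (cw_below X (Suc k))"

lemma cw_below_mono: "j \<le> k \<Longrightarrow> cw_below X j \<subseteq> cw_below X k"
  unfolding cw_below_def by (meson UN_mono lessThan_subset_iff order_refl)

lemma open_cell_subset_cw_below: "a \<in> cw_cells X k \<Longrightarrow> open_cell X k a \<subseteq> cw_below X (Suc k)"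
  unfolding cw_below_def by blast

context
  fixes X :: "('a, 'c) oriented_cw"
  assumes cw: "cw_complex X"
begin

lemma cw_map_continuous: "a \<in> cw_cells X k \<Longrightarrow> continuous_map (cell_disc k) (cw_space X) (cw_map X k a)"
  using cw unfolding cw_complex_def all_cells_def by auto

lemma cw_map_embedding: "a \<in> cw_cells X k \<Longrightarrow> embedding_map (cell_ball k) (cw_space X) (cw_map X k a)"
  using cw unfolding cw_complex_def all_cells_def by auto

lemma cw_orient_generator: "a \<in> cw_cells X k \<Longrightarrow> cell_generator k (cw_orient X k a)"
  using cw unfolding cw_complex_def all_cells_def by auto

lemma Hausdorff_cw_space: "Hausdorff_space (cw_space X)"
  using cw unfolding cw_complex_def by auto

lemma open_cells_disjoint:
  assumes "a \<in> cw_cells X k" "b \<in> cw_cells X j" "(k, a) \<noteq> (j, b)"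
  shows "open_cell X k a \<inter> open_cell X j b = {}"
proof -
  have "disjoint_family_on (\<lambda>(k, a). open_cell X k a) (all_cells X)"
    using cw unfolding cw_complex_def by auto
  from disjoint_family_onD [OF this, of "(k, a)" "(j, b)"] show ?thesis
    using assms by (auto simp: all_cells_def)
qed

lemma open_cell_Int_cw_below:
  assumes "a \<in> cw_cells X k"
  shows "open_cell X k a \<inter> cw_below X k = {}"
proof -
  have "open_cell X k a \<inter> open_cell X j b = {}" if "j < k" "b \<in> cw_cells X j" for j b
    using that by (intro open_cells_disjoint [OF assms]) auto
  then show ?thesis
    unfolding cw_below_def by blast
qed

lemma cw_map_sphere:
  assumes "a \<in> cw_cells X k"
  shows "cw_map X k a ` topspace (cell_sphere k) \<subseteq> cw_below X k"
proof -
  have "\<forall>(k, a) \<in> all_cells X. \<exists>F. finite F \<and> F \<subseteq> all_cells X \<and> (\<forall>(j, b) \<in> F. j < k) \<and>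
      cw_map X k a ` topspace (cell_sphere k) \<subseteq> (\<Union>(j, b) \<in> F. open_cell X j b)"
    using cw unfolding cw_complex_def by (elim conjE)
  moreover have "(k, a) \<in> all_cells X"
    using assms by (simp add: all_cells_def)
  ultimately obtain F where F: "F \<subseteq> all_cells X" "\<forall>(j, b) \<in> F. j < k"
      "cw_map X k a ` topspace (cell_sphere k) \<subseteq> (\<Union>(j, b) \<in> F. open_cell X j b)"
    by fast
  moreover have "(\<Union>(j, b) \<in> F. open_cell X j b) \<subseteq> cw_below X k"
    using F(1,2) unfolding cw_below_def all_cells_def by fast
  ultimately show ?thesis
    by blast
qed

lemma cw_map_disc:
  "a \<in> cw_cells X k \<Longrightarrow> cw_map X k a ` topspace (cell_disc k) \<subseteq> open_cell X k a \<union> cw_below X k"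
  using cw_map_sphere [of a k] unfolding topspace_cell_disc_Un open_cell_def image_Un by blast

lemma cw_map_disc_below:
  assumes "a \<in> cw_cells X k"
  shows "cw_map X k a ` topspace (cell_disc k) \<subseteq> cw_below X (Suc k)"
  using cw_map_disc [OF assms] open_cell_subset_cw_below [OF assms] cw_below_mono [of k "Suc k" X]
  by auto

lemma cw_below_subset_topspace: "cw_below X k \<subseteq> topspace (cw_space X)"
proof -
  have "open_cell X j a \<subseteq> topspace (cw_space X)" if "a \<in> cw_cells X j" for j a
    using continuous_map_image_subset_topspace [OF cw_map_continuous [OF that]]
    unfolding open_cell_def topspace_cell_disc_Un by blast
  then show ?thesis
    unfolding cw_below_def by blast
qed

lemma topspace_skeleton: "topspace (skeleton X k) = cw_below X (Suc k)"
  using cw_below_subset_topspace by (auto simp: skeleton_def)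

text \<open>The image of the compact disc is closed because the space is Hausdorff.\<close>

lemma closure_of_open_cell:
  assumes "a \<in> cw_cells X k"
  shows "(cw_space X closure_of open_cell X k a) \<subseteq> cw_map X k a ` topspace (cell_disc k)"
proof (rule closure_of_minimal)
  have "compactin (cw_space X) (cw_map X k a ` topspace (cell_disc k))"
    using image_compactin [OF _ cw_map_continuous [OF assms]] compact_cell_disc [of k]
    by (simp add: compact_space_def)
  then show "closedin (cw_space X) (cw_map X k a ` topspace (cell_disc k))"
    by (rule compactin_imp_closedin [OF Hausdorff_cw_space])
  show "open_cell X k a \<subseteq> cw_map X k a ` topspace (cell_disc k)"
    unfolding open_cell_def topspace_cell_disc_Un by blast
qed

text \<open>The rest of the skeleton is the union of the other cells of dimension at most
  \<open>k\<close>. By local finiteness its closure is the union of their closures, and the closure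
  of a cell adds only points of cells of smaller dimension, none of which lie in the given
  k-cell.\<close>

lemma openin_open_cell:
  assumes lf: "cw_locally_finite X" and a: "a \<in> cw_cells X k"
  shows "openin (skeleton X k) (open_cell X k a)"
proof -
  let ?I = "(SIGMA j:{..k}. cw_cells X j) - {(k, a)}"
  let ?A = "(\<lambda>(j, b). open_cell X j b) ` ?I"
  have "locally_finite_in (cw_space X) ?A"
    by (rule locally_finite_in_subset [OF lf [unfolded cw_locally_finite_def]]) (intro image_mono, auto simp: all_cells_def)
  then have closure: "(cw_space X closure_of \<Union>?A) = (\<Union>S\<in>?A. cw_space X closure_of S)"
    by (rule closure_of_locally_finite_Union)
  have U: "\<Union>?A = cw_below X (Suc k) - open_cell X k a"
  proof
    have "open_cell X j b \<subseteq> cw_below X (Suc k) - open_cell X k a" if "(j, b) \<in> ?I" for j b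
      using that open_cells_disjoint [OF a, of b j] open_cell_subset_cw_below [of b X j]
        cw_below_mono [of "Suc j" "Suc k" X] by auto
    then show "\<Union>?A \<subseteq> cw_below X (Suc k) - open_cell X k a"
      by blast
    show "cw_below X (Suc k) - open_cell X k a \<subseteq> \<Union>?A"
      unfolding cw_below_def by (clarsimp simp: less_Suc_eq_le) blast
  qed
  have "(cw_space X closure_of S) \<subseteq> \<Union>?A" if S: "S \<in> ?A" for S
  proof -
    obtain j b where jb: "b \<in> cw_cells X j" "j \<le> k" "(j, b) \<noteq> (k, a)" "S = open_cell X j b"
      using S by auto
    have "(cw_space X closure_of S) \<subseteq> open_cell X j b \<union> cw_below X j"
      unfolding jb(4) using closure_of_open_cell [OF jb(1)] cw_map_disc [OF jb(1)] by (rule order_trans)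
    moreover have "open_cell X j b \<subseteq> \<Union>?A"
      unfolding jb(4) [symmetric] using S by (rule Union_upper)
    moreover have "cw_below X j \<subseteq> \<Union>?A"
      using open_cell_Int_cw_below [OF a] cw_below_mono [of j k X] cw_below_mono [of k "Suc k" X] jb
      unfolding U by auto
    ultimately show ?thesis by blast
  qed
  then have "(cw_space X closure_of \<Union>?A) \<subseteq> \<Union>?A"
    unfolding closure by blast
  moreover have "\<Union>?A \<subseteq> topspace (cw_space X)"
    unfolding U using cw_below_subset_topspace by blast
  ultimately have "closedin (cw_space X) (\<Union>?A)"
    unfolding closure_of_subset_eq [symmetric] by blast
  then have "closedin (skeleton X k) (cw_below X (Suc k) - open_cell X k a)"
    unfolding U skeleton_def closedin_subtopology by blast
  then show ?thesis
    using open_cell_subset_cw_below [OF a] topspace_skeleton [of k]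
    by (simp add: openin_closedin double_diff)
qed

end

text \<open>For a \<open>k\<close>-cell \<open>c\<close> with center \<open>p\<close>, this is the map
  \<open>H\<^sub>k(X\<^sup>k, X\<^sup>k\<^sup>-\<^sup>1) \<rightarrow> H\<^sub>k(X\<^sup>k, X\<^sup>k - p)\<close>, which reads off the coefficient of \<open>c\<close>.\<close>

definition local_degree :: "('a, 'c) oriented_cw \<Rightarrow> nat \<Rightarrow> 'c \<Rightarrow> 'a chain set \<Rightarrow> 'a chain set" where
  "local_degree X k c = hom_induced (int k) (skeleton X k) (cw_below X k)
     (skeleton X k) (topspace (skeleton X k) - {cw_map X k c (\<lambda>_. 0)}) id"

definition local_group :: "('a, 'c) oriented_cw \<Rightarrow> nat \<Rightarrow> 'c \<Rightarrow> 'a chain set monoid" where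
  "local_group X k c = relative_homology_group (int k) (skeleton X k)
     (topspace (skeleton X k) - {cw_map X k c (\<lambda>_. 0)})"

lemma center_in_open_cell: "cw_map X k c (\<lambda>_. 0) \<in> open_cell X k c"
  unfolding open_cell_def using zero_in_cell_ball by blast

lemma cell_class_in_carrier: "cell_class X k b \<in> carrier (cellular_group X k)"
  by (simp add: cell_class_def cellular_group_def hom_induced_carrier)

lemma local_degree_hom: "local_degree X k c \<in> hom (cellular_group X k) (local_group X k c)"
  unfolding local_degree_def cellular_group_def local_group_def skeleton_def
  by (rule hom_induced_hom)

context
  fixes X :: "('a, 'c) oriented_cw"
  assumes cw: "cw_complex X"
begin

lemma continuous_map_skeleton:
  "a \<in> cw_cells X k \<Longrightarrow> continuous_map (cell_disc k) (skeleton X k) (cw_map X k a)"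
  using cw_map_continuous [OF cw, of a k] cw_map_disc_below [OF cw, of a k]
  by (auto simp: skeleton_def continuous_map_in_subtopology)

lemma embedding_map_skeleton:
  "a \<in> cw_cells X k \<Longrightarrow> embedding_map (cell_ball k) (skeleton X k) (cw_map X k a)"
  using cw_map_embedding [OF cw] open_cell_subset_cw_below [of a X k]
  by (simp add: skeleton_def embedding_map_in_subtopology open_cell_def)

text \<open>The center of a k-cell avoids all lower cells, so both maps are maps of pairs and
  functoriality applies.\<close>

lemma local_degree_cell_class:
  assumes "b \<in> cw_cells X k" "c \<in> cw_cells X k"
  shows "local_degree X k c (cell_class X k b) =
    hom_induced (int k) (cell_disc k) (topspace (cell_sphere k)) (skeleton X k)
      (topspace (skeleton X k) - {cw_map X k c (\<lambda>_. 0)}) (cw_map X k b) (cw_orient X k b)"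
proof -
  have "id \<in> cw_below X k \<rightarrow> topspace (skeleton X k) - {cw_map X k c (\<lambda>_. 0)}"
    using open_cell_Int_cw_below [OF cw assms(2)] center_in_open_cell [of X k c]
      cw_below_mono [of k "Suc k" X] unfolding topspace_skeleton [OF cw] by auto
  moreover have "cw_map X k b \<in> topspace (cell_sphere k) \<rightarrow> cw_below X k"
    using cw_map_sphere [OF cw assms(1)] by blast
  ultimately show ?thesis
    using hom_induced_compose' [OF continuous_map_skeleton [OF assms(1)] _ continuous_map_id]
    unfolding local_degree_def cell_class_def skeleton_def [symmetric] id_o by blast
qed

text \<open>The closed cell \<open>b\<close> misses the center of \<open>c\<close>, so the map
  factors through the homology of a space relative to itself, which is trivial.\<close>

lemma local_degree_other:
  assumes "b \<in> cw_cells X k" "c \<in> cw_cells X k" "b \<noteq> c"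
  shows "local_degree X k c (cell_class X k b) = \<one>\<^bsub>local_group X k c\<^esub>"
proof -
  let ?P = "topspace (skeleton X k) - {cw_map X k c (\<lambda>_. 0)}"
  let ?S = "topspace (cell_sphere k)"
  have "cw_map X k b ` topspace (cell_disc k) \<subseteq> open_cell X k b \<union> cw_below X k"
    using cw_map_disc [OF cw assms(1)] .
  moreover have "cw_map X k c (\<lambda>_. 0) \<notin> open_cell X k b \<union> cw_below X k"
    using open_cell_Int_cw_below [OF cw assms(2)] open_cells_disjoint [OF cw assms(2,1)]
      center_in_open_cell [of X k c] assms(3) by auto
  ultimately have im: "cw_map X k b ` topspace (cell_disc k) \<subseteq> ?P"
    using cw_map_disc_below [OF cw assms(1)] unfolding topspace_skeleton [OF cw] by blast
  then have imS: "cw_map X k b \<in> ?S \<rightarrow> ?P"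
    unfolding topspace_cell_disc_Un by blast
  have cont: "continuous_map (cell_disc k) (subtopology (skeleton X k) ?P) (cw_map X k b)"
    using continuous_map_skeleton [OF assms(1)] im by (simp add: continuous_map_in_subtopology image_subset_iff_funcset)
  have "local_degree X k c (cell_class X k b) =
      hom_induced (int k) (subtopology (skeleton X k) ?P) ?P (skeleton X k) ?P id
        (hom_induced (int k) (cell_disc k) ?S (subtopology (skeleton X k) ?P) ?P
          (cw_map X k b) (cw_orient X k b))"
    unfolding local_degree_cell_class [OF assms(1,2)]
    by (subst hom_induced_compose' [OF cont]) (simp_all add: imS continuous_map_from_subtopology)
  moreover have "trivial_group (relative_homology_group (int k) (subtopology (skeleton X k) ?P) ?P)"
    using trivial_relative_homology_group_topspace [of "int k" "subtopology (skeleton X k) ?P"]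
    by (simp add: Int_absorb1)
  then have "hom_induced (int k) (cell_disc k) ?S (subtopology (skeleton X k) ?P) ?P
      (cw_map X k b) (cw_orient X k b) =
      \<one>\<^bsub>relative_homology_group (int k) (subtopology (skeleton X k) ?P) ?P\<^esub>"
    unfolding trivial_group_def by (metis (no_types) hom_induced_carrier singletonD)
  ultimately show ?thesis
    unfolding local_group_def
    by (metis (no_types) hom_one [OF hom_induced_hom] group_relative_homology_group)
qed

text \<open>The orientation has infinite order in the homology of the disc modulo its sphere, and
  the characteristic map is injective into the local homology at the center.\<close>

lemma local_degree_self_torsion_free:
  fixes m :: int
  assumes lf: "cw_locally_finite X" and c: "c \<in> cw_cells X k"
    and m: "local_degree X k c (cell_class X k c) [^]\<^bsub>local_group X k c\<^esub> m = \<one>\<^bsub>local_group X k c\<^esub>"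
  shows "m = 0"
proof -
  let ?G = "relative_homology_group (int k) (cell_disc k) (topspace (cell_sphere k))"
  let ?h = "hom_induced (int k) (cell_disc k) (topspace (cell_sphere k)) (skeleton X k)
      (topspace (skeleton X k) - {cw_map X k c (\<lambda>_. 0)}) (cw_map X k c)"
  interpret G: group ?G
    by simp
  have gen: "cw_orient X k c \<in> carrier ?G"
    using cw_orient_generator [OF cw c] by (simp add: cell_generator_def Let_def)
  have hom: "?h \<in> hom ?G (local_group X k c)"
    unfolding local_group_def by (rule hom_induced_hom)
  have inj: "inj_on ?h (carrier ?G)"
  proof (rule inj_on_hom_induced_punctured)
    show "Hausdorff_space (skeleton X k)"
      by (simp add: skeleton_def Hausdorff_space_subtopology Hausdorff_cw_space [OF cw])
    show "openin (skeleton X k) (cw_map X k c ` topspace (cell_ball k))"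
      using openin_open_cell [OF cw lf c] by (simp add: open_cell_def)
    show "cw_map X k c ` topspace (cell_sphere k) \<inter> cw_map X k c ` topspace (cell_ball k) = {}"
      using cw_map_sphere [OF cw c] open_cell_Int_cw_below [OF cw c] by (auto simp: open_cell_def)
  qed (use continuous_map_skeleton [OF c] embedding_map_skeleton [OF c] in auto)
  have "?h (cw_orient X k c [^]\<^bsub>?G\<^esub> m) = \<one>\<^bsub>local_group X k c\<^esub>"
    using hom_int_pow [OF hom gen, of m] m local_degree_cell_class [OF c c]
    by (simp add: local_group_def)
  also have "\<dots> = ?h \<one>\<^bsub>?G\<^esub>"
    using hom_one [OF hom] by (simp add: local_group_def)
  finally have "cw_orient X k c [^]\<^bsub>?G\<^esub> m = \<one>\<^bsub>?G\<^esub>"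
    by (rule inj_onD [OF inj _ G.int_pow_closed [OF gen] G.one_closed])
  then show ?thesis
    using cell_generator_torsion_free [OF cw_orient_generator [OF cw c]] by blast
qed

end

section \<open>The cellular boundary squares to zero\<close>

text \<open>In multiplicative notation, a homomorphism evaluated on an integral combination of
  elements that it sends to multiples of one element. It serves for the local degree and for its
  composite with the cellular boundary.\<close>

lemma hom_finprod_int_pow:
  fixes m e :: "'i \<Rightarrow> int"
  assumes G: "comm_group G" and H: "group H" and h: "h \<in> hom G H"
    and g: "g \<in> carrier H" and fin: "finite B"
    and x: "\<And>b. b \<in> B \<Longrightarrow> x b \<in> carrier G"
    and hx: "\<And>b. b \<in> B \<Longrightarrow> h (x b) = g [^]\<^bsub>H\<^esub> e b"
  shows "h (\<Otimes>\<^bsub>G\<^esub>b\<in>B. x b [^]\<^bsub>G\<^esub> m b) = g [^]\<^bsub>H\<^esub> (\<Sum>b\<in>B. m b * e b)"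
proof -
  interpret G: comm_group G by (rule G)
  interpret H: group H by (rule H)
  show ?thesis
    using fin x hx
  proof (induction B rule: finite_induct)
    case empty
    then show ?case
      using hom_one [OF h G.is_group H] by simp
  next
    case (insert b B)
    have pow: "x c [^]\<^bsub>G\<^esub> m c \<in> carrier G" if "c \<in> insert b B" for c
      using insert.prems(1) [OF that] by simp
    have "h (\<Otimes>\<^bsub>G\<^esub>b\<in>insert b B. x b [^]\<^bsub>G\<^esub> m b) =
        h (x b [^]\<^bsub>G\<^esub> m b \<otimes>\<^bsub>G\<^esub> (\<Otimes>\<^bsub>G\<^esub>b\<in>B. x b [^]\<^bsub>G\<^esub> m b))"
      using insert.hyps pow by (subst G.finprod_insert) auto
    also have "\<dots> = h (x b [^]\<^bsub>G\<^esub> m b) \<otimes>\<^bsub>H\<^esub> h (\<Otimes>\<^bsub>G\<^esub>b\<in>B. x b [^]\<^bsub>G\<^esub> m b)"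
      using pow by (intro hom_mult [OF h] G.finprod_closed) auto
    also have "h (x b [^]\<^bsub>G\<^esub> m b) = g [^]\<^bsub>H\<^esub> (m b * e b)"
      using hom_int_pow [OF h _ G.is_group H, of "x b" "m b"] insert.prems g
      by (simp add: H.int_pow_pow mult.commute)
    also have "h (\<Otimes>\<^bsub>G\<^esub>b\<in>B. x b [^]\<^bsub>G\<^esub> m b) = g [^]\<^bsub>H\<^esub> (\<Sum>b\<in>B. m b * e b)"
      using insert by simp
    finally show ?case
      using insert.hyps g by (simp add: H.int_pow_mult)
  qed
qed

lemma cellular_boundary_hom: "cellular_boundary X k \<in> hom (cellular_group X (Suc k)) (cellular_group X k)"
proof -
  let ?Y = "subtopology (cw_space X) (cw_below X (Suc (Suc k)))"
  have "subtopology ?Y (cw_below X (Suc k)) = skeleton X k"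
    using cw_below_mono [of "Suc k" "Suc (Suc k)" X]
    by (simp add: skeleton_def subtopology_subtopology Int_absorb1)
  then have "hom_boundary (int (Suc k)) ?Y (cw_below X (Suc k))
      \<in> hom (cellular_group X (Suc k)) (homology_group (int k) (skeleton X k))"
    using hom_boundary_hom [of "int (Suc k)" ?Y "cw_below X (Suc k)"]
    by (simp add: cellular_group_def)
  moreover have "hom_induced (int k) (skeleton X k) {} (skeleton X k) (cw_below X k) id
      \<in> hom (homology_group (int k) (skeleton X k)) (cellular_group X k)"
    unfolding cellular_group_def skeleton_def by (rule hom_induced_hom)
  ultimately have "hom_induced (int k) (skeleton X k) {} (skeleton X k) (cw_below X k) id \<circ>
      hom_boundary (int (Suc k)) ?Y (cw_below X (Suc k)) \<in> hom (cellular_group X (Suc k)) (cellular_group X k)"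
    by (rule hom_compose)
  moreover have "cellular_boundary X k = hom_induced (int k) (skeleton X k) {} (skeleton X k) (cw_below X k) id \<circ>
      hom_boundary (int (Suc k)) ?Y (cw_below X (Suc k))"
    by (simp add: fun_eq_iff cellular_boundary_def skeleton_def)
  ultimately show ?thesis by simp
qed

lemma group_cellular_group: "group (cellular_group X k)"
  and comm_group_cellular_group: "comm_group (cellular_group X k)"
  by (simp_all add: cellular_group_def)

text \<open>The middle two of the four maps composed here are consecutive in the long exact sequence
  of the (k+1)-skeleton modulo the k-skeleton.\<close>

lemma cellular_boundary_boundary:
  assumes "x \<in> carrier (cellular_group X (Suc (Suc k)))"
  shows "cellular_boundary X k (cellular_boundary X (Suc k) x) = \<one>\<^bsub>cellular_group X k\<^esub>"
proof -
  let ?p = "int (Suc k)" and ?S = "cw_below X (Suc k)"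
  let ?Y = "subtopology (cw_space X) (cw_below X (Suc (Suc k)))"
  let ?Z = "subtopology (cw_space X) (cw_below X (Suc (Suc (Suc k))))"
  have eq: "subtopology ?Z (cw_below X (Suc (Suc k))) = ?Y"
    using cw_below_mono [of "Suc (Suc k)" "Suc (Suc (Suc k))" X]
    by (simp add: subtopology_subtopology Int_absorb1)
  have eq': "subtopology ?Y ?S = skeleton X k"
    using cw_below_mono [of "Suc k" "Suc (Suc k)" X]
    by (simp add: skeleton_def subtopology_subtopology Int_absorb1)
  define y where "y = hom_boundary (int (Suc (Suc k))) ?Z (cw_below X (Suc (Suc k))) x"
  have y: "y \<in> carrier (homology_group ?p ?Y)"
    using hom_boundary_carrier [of "int (Suc (Suc k))" ?Z "cw_below X (Suc (Suc k))" x]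
    unfolding y_def eq by simp
  have "hom_induced ?p ?Y {} ?Y ?S id y \<in>
      kernel (relative_homology_group ?p ?Y ?S) (homology_group (?p - 1) (subtopology ?Y ?S)) (hom_boundary ?p ?Y ?S)"
    using homology_exactness_axiom_1 [of ?p ?Y ?S] y by auto
  then have "hom_boundary ?p ?Y ?S (hom_induced ?p ?Y {} ?Y ?S id y) = \<one>\<^bsub>homology_group (int k) (skeleton X k)\<^esub>"
    unfolding kernel_def eq' by simp
  then have "cellular_boundary X k (cellular_boundary X (Suc k) x) =
      hom_induced (int k) (skeleton X k) {} (skeleton X k) (cw_below X k) id
        \<one>\<^bsub>homology_group (int k) (skeleton X k)\<^esub>"
    unfolding cellular_boundary_def y_def skeleton_def by simp
  also have "\<dots> = \<one>\<^bsub>cellular_group X k\<^esub>"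
    unfolding cellular_group_def skeleton_def by (rule hom_one [OF hom_induced_hom]) simp_all
  finally show ?thesis .
qed

text \<open>The local degree at \<open>c\<close> sends the class of \<open>c\<close> to
  \<open>?g\<close> and every other k-cell to the identity. Applied to the vanishing double boundary
  of \<open>a\<close>, it yields \<open>?g\<close> raised to the sum in question, and
  \<open>?g\<close> has infinite order.\<close>

lemma incidence_numbers_boundary_boundary:
  assumes cw: "cw_complex X" and lf: "cw_locally_finite X" and n: "incidence_numbers X n"
    and a: "a \<in> cw_cells X (Suc (Suc k))" and c: "c \<in> cw_cells X k"
  shows "(\<Sum>b | b \<in> cw_cells X (Suc k) \<and> n (Suc k) a b \<noteq> 0. n (Suc k) a b * n k b c) = 0"
proof -
  let ?G = "cellular_group X" and ?H = "local_group X k c"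
  let ?g = "local_degree X k c (cell_class X k c)"
  have H: "group ?H"
    by (simp add: local_group_def)
  have g: "?g \<in> carrier ?H"
    using local_degree_hom cell_class_in_carrier by (rule hom_in_carrier)
  have fin: "finite {b \<in> cw_cells X j. n j a b \<noteq> 0}"
    and bd: "cellular_boundary X j (cell_class X (Suc j) a) =
      (\<Otimes>\<^bsub>?G j\<^esub>b\<in>{b \<in> cw_cells X j. n j a b \<noteq> 0}. cell_class X j b [^]\<^bsub>?G j\<^esub> n j a b)"
    if "a \<in> cw_cells X (Suc j)" for j a
    using n [unfolded incidence_numbers_def, rule_format, OF that] by (rule conjunct1, rule conjunct2)
  have eval: "(local_degree X k c \<circ> cellular_boundary X k) (cell_class X (Suc k) b) = ?g [^]\<^bsub>?H\<^esub> n k b c"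
    if b: "b \<in> cw_cells X (Suc k)" for b
  proof -
    have deg: "local_degree X k c (cell_class X k b') = ?g [^]\<^bsub>?H\<^esub> (of_bool (b' = c) :: int)"
      if "b' \<in> cw_cells X k" for b'
      using local_degree_other [OF cw that c] g H
      by (cases "b' = c") (simp_all add: group.int_pow_1)
    have "(local_degree X k c \<circ> cellular_boundary X k) (cell_class X (Suc k) b) =
        ?g [^]\<^bsub>?H\<^esub> (\<Sum>b'\<in>{b' \<in> cw_cells X k. n k b b' \<noteq> 0}. n k b b' * of_bool (b' = c))"
      unfolding o_apply bd [OF b]
      by (rule hom_finprod_int_pow [OF comm_group_cellular_group H local_degree_hom g fin [OF b]])
        (simp_all add: cell_class_in_carrier deg)
    also have "(\<Sum>b'\<in>{b' \<in> cw_cells X k. n k b b' \<noteq> 0}. n k b b' * of_bool (b' = c)) = n k b c"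
      using fin [OF b] c by (simp add: of_bool_def if_distrib sum.delta cong: if_cong)
    finally show ?thesis .
  qed
  have "?g [^]\<^bsub>?H\<^esub> (\<Sum>b | b \<in> cw_cells X (Suc k) \<and> n (Suc k) a b \<noteq> 0. n (Suc k) a b * n k b c) =
      (local_degree X k c \<circ> cellular_boundary X k) (cellular_boundary X (Suc k) (cell_class X (Suc (Suc k)) a))"
    unfolding bd [OF a]
    by (rule sym, rule hom_finprod_int_pow [OF comm_group_cellular_group H
          hom_compose [OF cellular_boundary_hom local_degree_hom] g fin [OF a]])
      (use eval cell_class_in_carrier in auto)
  also have "\<dots> = \<one>\<^bsub>?H\<^esub>"
    using cellular_boundary_boundary [OF cell_class_in_carrier, of X k a]
      hom_one [OF local_degree_hom group_cellular_group H] by simp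
  finally show ?thesis
    by (rule local_degree_self_torsion_free [OF cw lf c])
qed

section \<open>Square-summable functions\<close>

lemma l2_imp_UNIV: "u \<in> l2 E \<Longrightarrow> u \<in> l2 UNIV"
  by (auto simp: l2_def)

lemma l2_zero: "(\<lambda>_. 0) \<in> l2 E"
  by (simp add: l2_def)

lemma l2_scale:
  assumes "u \<in> l2 E"
  shows "(\<lambda>x. c * u x) \<in> l2 E"
  using assms by (auto simp: l2_def norm_mult power_mult_distrib intro: summable_on_cmult_right)

lemma l2_add:
  assumes "u \<in> l2 E" "v \<in> l2 E"
  shows "(\<lambda>x. u x + v x) \<in> l2 E"
proof -
  have bound: "(cmod (a + b))\<^sup>2 \<le> 2 * (cmod a)\<^sup>2 + 2 * (cmod b)\<^sup>2" for a b :: complex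
  proof -
    have "(cmod (a + b))\<^sup>2 \<le> (cmod a + cmod b)\<^sup>2"
      by (intro power_mono norm_triangle_ineq) auto
    also have "\<dots> \<le> 2 * (cmod a)\<^sup>2 + 2 * (cmod b)\<^sup>2"
      using sum_squares_bound [of "cmod a" "cmod b"] by (simp add: power2_sum)
    finally show ?thesis .
  qed
  have "(\<lambda>x. 2 * (cmod (u x))\<^sup>2 + 2 * (cmod (v x))\<^sup>2) summable_on UNIV"
    using assms by (intro summable_on_add summable_on_cmult_right) (auto simp: l2_def)
  then have "(\<lambda>x. (cmod (u x + v x))\<^sup>2) summable_on UNIV"
    by (rule summable_on_comparison_test) (auto intro: bound)
  then show ?thesis
    using assms by (auto simp: l2_def)
qed

lemma l2_diff:
  assumes "u \<in> l2 E" "v \<in> l2 E"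
  shows "(\<lambda>x. u x - v x) \<in> l2 E"
  using l2_add [OF assms(1) l2_scale [OF assms(2), of "-1"]] by simp

lemma l2_of_finite_support:
  assumes "finite {x. u x \<noteq> 0}" "{x. u x \<noteq> 0} \<subseteq> E"
  shows "u \<in> l2 E"
proof -
  have "(\<lambda>x. (cmod (u x))\<^sup>2) summable_on {x. u x \<noteq> 0}"
    using assms(1) by (rule summable_on_finite)
  then have "(\<lambda>x. (cmod (u x))\<^sup>2) summable_on UNIV"
    by (subst summable_on_cong_neutral [where T = "{x. u x \<noteq> 0}"]) auto
  then show ?thesis
    using assms by (auto simp: l2_def)
qed

lemma l2_inner_summable:
  assumes "u \<in> l2 UNIV" "v \<in> l2 UNIV"
  shows "(\<lambda>x. u x * cnj (v x)) summable_on UNIV"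
proof -
  have bound: "norm (a * cnj b) \<le> (cmod a)\<^sup>2 + (cmod b)\<^sup>2" for a b
  proof -
    have "2 * (cmod a * cmod b) \<le> (cmod a)\<^sup>2 + (cmod b)\<^sup>2" "0 \<le> cmod a * cmod b"
      using sum_squares_bound [of "cmod a" "cmod b"] by simp_all
    then show ?thesis
      unfolding norm_mult complex_mod_cnj by linarith
  qed
  have "(\<lambda>x. (cmod (u x))\<^sup>2 + (cmod (v x))\<^sup>2) summable_on UNIV"
    using assms by (intro summable_on_add) (auto simp: l2_def)
  then have "(\<lambda>x. norm (u x * cnj (v x))) summable_on UNIV"
    by (rule summable_on_comparison_test) (auto intro: bound)
  then show ?thesis
    by (rule abs_summable_summable)
qed

section \<open>Sesquilinearity, norm and the Cauchy-Schwarz inequality\<close>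

lemma l2_inner_add_left:
  assumes "u \<in> l2 UNIV" "v \<in> l2 UNIV" "w \<in> l2 UNIV"
  shows "l2_inner (\<lambda>x. u x + v x) w = l2_inner u w + l2_inner v w"
  unfolding l2_inner_def using infsum_add [OF l2_inner_summable l2_inner_summable, OF assms(1,3,2,3)]
  by (simp add: distrib_right)

text \<open>Unlike additivity, this holds for arbitrary functions: a nonzero factor does not affect
  convergence, and a divergent \<open>infsum\<close> is 0.\<close>

lemma l2_inner_scale_left: "l2_inner (\<lambda>x. c * u x) w = c * l2_inner u w"
  unfolding l2_inner_def by (simp add: mult.assoc infsum_cmult_right')

lemma l2_inner_commute: "l2_inner v u = cnj (l2_inner u v)"
  unfolding l2_inner_def by (simp add: infsum_cnj [symmetric] mult.commute)

lemma l2_inner_diff_left: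
  assumes "u \<in> l2 UNIV" "v \<in> l2 UNIV" "w \<in> l2 UNIV"
  shows "l2_inner (\<lambda>x. u x - v x) w = l2_inner u w - l2_inner v w"
  using l2_inner_add_left [OF assms(1) l2_scale [OF assms(2), of "-1"] assms(3)]
    l2_inner_scale_left [of "-1" v w] by simp

lemma l2_inner_scale_right: "l2_inner w (\<lambda>x. c * u x) = cnj c * l2_inner w u"
  using arg_cong [OF l2_inner_scale_left [of c u w], of cnj]
  by (simp add: l2_inner_commute [of w, symmetric])

lemma l2_inner_diff_right:
  assumes "u \<in> l2 UNIV" "v \<in> l2 UNIV" "w \<in> l2 UNIV"
  shows "l2_inner w (\<lambda>x. u x - v x) = l2_inner w u - l2_inner w v"
  using arg_cong [OF l2_inner_diff_left [OF assms], of cnj]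
  by (simp add: l2_inner_commute [of w, symmetric])

lemma l2_inner_zero [simp]: "l2_inner (\<lambda>_. 0) u = 0" "l2_inner u (\<lambda>_. 0) = 0"
  by (simp_all add: l2_inner_def)

lemma l2_norm_nonneg [simp]: "l2_norm u \<ge> 0"
  by (simp add: l2_norm_def infsum_nonneg)

lemma l2_norm_square: "(l2_norm u)\<^sup>2 = (\<Sum>\<^sub>\<infinity>x. (cmod (u x))\<^sup>2)"
  by (simp add: l2_norm_def infsum_nonneg)

lemma l2_inner_self:
  assumes "u \<in> l2 UNIV"
  shows "l2_inner u u = complex_of_real ((l2_norm u)\<^sup>2)"
proof -
  have "((\<lambda>x. (cmod (u x))\<^sup>2) has_sum (l2_norm u)\<^sup>2) UNIV"
    using assms unfolding l2_norm_square by (auto simp: l2_def)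
  then have "((\<lambda>x. complex_of_real ((cmod (u x))\<^sup>2)) has_sum complex_of_real ((l2_norm u)\<^sup>2)) UNIV"
    unfolding has_sum_of_real_iff .
  then show ?thesis
    unfolding l2_inner_def complex_norm_square [symmetric] by (rule infsumI)
qed

lemma l2_norm_scale: "l2_norm (\<lambda>x. c * u x) = cmod c * l2_norm u"
  by (simp add: l2_norm_def norm_mult power_mult_distrib infsum_cmult_right' real_sqrt_mult)

lemma l2_norm_minus_commute: "l2_norm (\<lambda>x. u x - v x) = l2_norm (\<lambda>x. v x - u x)"
  by (simp add: l2_norm_def norm_minus_commute)

text \<open>The common source of the Cauchy-Schwarz inequality, the parallelogram law, Pythagoras
  and the variational argument for the projection, each for its own value of
  \<open>t\<close>.\<close>

lemma l2_norm_diff_scale_square: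
  assumes "w \<in> l2 UNIV" "s \<in> l2 UNIV"
  shows "(l2_norm (\<lambda>x. w x - t * s x))\<^sup>2 =
    (l2_norm w)\<^sup>2 - 2 * Re (cnj t * l2_inner w s) + (cmod t)\<^sup>2 * (l2_norm s)\<^sup>2"
proof -
  note s = l2_scale [OF assms(2), of t]
  have "complex_of_real ((l2_norm (\<lambda>x. w x - t * s x))\<^sup>2) =
      l2_inner w w - (cnj t * l2_inner w s + cnj (cnj t * l2_inner w s)) + t * cnj t * l2_inner s s"
    unfolding l2_inner_self [OF l2_diff [OF assms(1) s], symmetric]
    using l2_inner_commute [of s w]
    by (simp add: l2_inner_diff_left [OF assms(1) s l2_diff [OF assms(1) s]]
        l2_inner_diff_right [OF assms(1) s] assms s l2_inner_scale_left l2_inner_scale_right algebra_simps)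
  also have "\<dots> = complex_of_real ((l2_norm w)\<^sup>2 - 2 * Re (cnj t * l2_inner w s) + (cmod t)\<^sup>2 * (l2_norm s)\<^sup>2)"
    unfolding l2_inner_self [OF assms(1)] l2_inner_self [OF assms(2)] complex_add_cnj complex_norm_square [symmetric] by simp
  finally show ?thesis
    unfolding of_real_eq_iff .
qed

lemma l2_norm_add_square:
  assumes "u \<in> l2 UNIV" "v \<in> l2 UNIV"
  shows "(l2_norm (\<lambda>x. u x + v x))\<^sup>2 = (l2_norm u)\<^sup>2 + 2 * Re (l2_inner u v) + (l2_norm v)\<^sup>2"
  using l2_norm_diff_scale_square [OF assms, of "-1"] by simp

lemma l2_sum_le_norm_square:
  assumes "u \<in> l2 UNIV" "finite F"
  shows "(\<Sum>x\<in>F. (cmod (u x))\<^sup>2) \<le> (l2_norm u)\<^sup>2"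
  unfolding l2_norm_square using assms by (intro finite_sum_le_infsum) (auto simp: l2_def)

lemma l2_norm_ge_component:
  assumes "u \<in> l2 UNIV"
  shows "cmod (u x) \<le> l2_norm u"
  by (rule power2_le_imp_le) (use l2_sum_le_norm_square [OF assms, of "{x}"] in simp_all)

lemma l2_norm_eq_0:
  assumes "u \<in> l2 UNIV" "l2_norm u = 0"
  shows "u = (\<lambda>_. 0)"
  using l2_norm_ge_component [OF assms(1)] assms(2) by auto

text \<open>A criterion for functions known only coordinatewise: limits of Cauchy sequences and
  images under bounded matrices.\<close>

lemma l2_of_bounded_sums:
  assumes "\<And>x. x \<notin> E \<Longrightarrow> u x = 0"
    and "\<And>F. finite F \<Longrightarrow> (\<Sum>x\<in>F. (cmod (u x))\<^sup>2) \<le> C"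
  shows "u \<in> l2 E" "(l2_norm u)\<^sup>2 \<le> C"
proof -
  have "(\<lambda>x. (cmod (u x))\<^sup>2) summable_on UNIV"
    by (rule nonneg_bdd_above_summable_on) (auto intro!: bdd_aboveI2 [where M = C] assms(2))
  then show "u \<in> l2 E" "(l2_norm u)\<^sup>2 \<le> C"
    unfolding l2_norm_square
    by (simp add: l2_def assms(1), rule infsum_le_finite_sums) (simp_all add: assms(2))
qed

lemma l2_Cauchy_Schwarz:
  assumes "w \<in> l2 UNIV" "s \<in> l2 UNIV"
  shows "cmod (l2_inner w s) \<le> l2_norm w * l2_norm s"
proof (cases "l2_norm s = 0")
  case True
  then show ?thesis
    using l2_norm_eq_0 [OF assms(2)] by simp
next
  case False
  define a where "a = l2_inner w s"
  define r where "r = (l2_norm s)\<^sup>2"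
  have r: "r > 0"
    using False by (simp add: r_def)
  \<comment> \<open>The factor \<open>a / r\<close> is the coefficient of the orthogonal projection
    of \<open>w\<close> onto the line through \<open>s\<close>.\<close>
  have "0 \<le> (l2_norm (\<lambda>x. w x - (a / r) * s x))\<^sup>2"
    by simp
  also have "\<dots> = (l2_norm w)\<^sup>2 - 2 * Re (cnj (a / r) * a) + (cmod (a / r))\<^sup>2 * r"
    unfolding l2_norm_diff_scale_square [OF assms] a_def r_def ..
  also have "cnj (a / r) * a = complex_of_real ((cmod a)\<^sup>2 / r)"
    unfolding of_real_divide complex_norm_square by (simp add: mult.commute)
  also have "(l2_norm w)\<^sup>2 - 2 * Re (complex_of_real ((cmod a)\<^sup>2 / r)) + (cmod (a / r))\<^sup>2 * r =
      (l2_norm w)\<^sup>2 - (cmod a)\<^sup>2 / r"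
    using r unfolding Re_complex_of_real norm_divide power_divide norm_of_real
    by (simp add: field_simps power2_eq_square)
  finally have "(cmod a)\<^sup>2 \<le> (l2_norm w * l2_norm s)\<^sup>2"
    using r by (simp add: field_simps r_def power_mult_distrib)
  then show ?thesis
    unfolding a_def by (rule power2_le_imp_le) simp
qed

lemma l2_norm_triangle:
  assumes "u \<in> l2 UNIV" "v \<in> l2 UNIV"
  shows "l2_norm (\<lambda>x. u x + v x) \<le> l2_norm u + l2_norm v"
proof (rule power2_le_imp_le)
  have "Re (l2_inner u v) \<le> l2_norm u * l2_norm v"
    by (rule order_trans [OF complex_Re_le_cmod l2_Cauchy_Schwarz [OF assms]])
  then show "(l2_norm (\<lambda>x. u x + v x))\<^sup>2 \<le> (l2_norm u + l2_norm v)\<^sup>2"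
    unfolding l2_norm_add_square [OF assms] by (simp add: power2_sum)
qed simp

lemma l2_dist_triangle:
  assumes "u \<in> l2 UNIV" "v \<in> l2 UNIV" "w \<in> l2 UNIV"
  shows "l2_norm (\<lambda>x. u x - w x) \<le> l2_norm (\<lambda>x. u x - v x) + l2_norm (\<lambda>x. v x - w x)"
  using l2_norm_triangle [OF l2_diff l2_diff, OF assms(1,2,2,3)] by simp

section \<open>Closed subspaces\<close>

definition l2_subspace :: "'c set \<Rightarrow> ('c \<Rightarrow> complex) set \<Rightarrow> bool" where
  "l2_subspace E S \<longleftrightarrow> S \<subseteq> l2 E \<and> (\<lambda>_. 0) \<in> S \<and>
     (\<forall>u\<in>S. \<forall>v\<in>S. (\<lambda>x. u x + v x) \<in> S) \<and> (\<forall>c. \<forall>u\<in>S. (\<lambda>x. c * u x) \<in> S)"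

lemma l2_subspaceD:
  assumes "l2_subspace E S"
  shows "u \<in> S \<Longrightarrow> u \<in> l2 E" "u \<in> S \<Longrightarrow> u \<in> l2 UNIV" "(\<lambda>_. 0) \<in> S"
    "u \<in> S \<Longrightarrow> v \<in> S \<Longrightarrow> (\<lambda>x. u x + v x) \<in> S" "u \<in> S \<Longrightarrow> (\<lambda>x. c * u x) \<in> S"
  using assms unfolding l2_subspace_def by (auto dest: l2_imp_UNIV)

lemma l2_subspace_diff:
  assumes "l2_subspace E S" "u \<in> S" "v \<in> S"
  shows "(\<lambda>x. u x - v x) \<in> S"
  using l2_subspaceD(4) [OF assms(1,2) l2_subspaceD(5) [OF assms(1,3), of "-1"]] by simp

lemma l2_closure_superset: "S \<subseteq> l2 E \<Longrightarrow> S \<subseteq> l2_closure E S"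
  unfolding l2_closure_def by (force simp: l2_norm_def)

lemma l2_closure_mono: "S \<subseteq> T \<Longrightarrow> l2_closure E S \<subseteq> l2_closure E T"
  unfolding l2_closure_def by blast

lemma l2_closure_subset: "l2_closure E S \<subseteq> l2 E"
  unfolding l2_closure_def by blast

lemma l2_closureE:
  assumes "u \<in> l2_closure E S" "\<epsilon> > 0"
  obtains s where "s \<in> S" "l2_norm (\<lambda>x. u x - s x) < \<epsilon>"
  using assms unfolding l2_closure_def by blast

lemma l2_closure_idem:
  assumes "S \<subseteq> l2 E"
  shows "l2_closure E (l2_closure E S) = l2_closure E S"
proof
  show "l2_closure E S \<subseteq> l2_closure E (l2_closure E S)"
    by (intro l2_closure_superset l2_closure_subset)
  show "l2_closure E (l2_closure E S) \<subseteq> l2_closure E S"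
  proof
    fix u assume u: "u \<in> l2_closure E (l2_closure E S)"
    have "\<exists>s\<in>S. l2_norm (\<lambda>x. u x - s x) < \<epsilon>" if e: "\<epsilon> > 0" for \<epsilon>
    proof -
      obtain v where v: "v \<in> l2_closure E S" "l2_norm (\<lambda>x. u x - v x) < \<epsilon> / 2"
        using l2_closureE [OF u half_gt_zero [OF e]] .
      obtain s where s: "s \<in> S" "l2_norm (\<lambda>x. v x - s x) < \<epsilon> / 2"
        using l2_closureE [OF v(1) half_gt_zero [OF e]] .
      have "u \<in> l2 UNIV" "v \<in> l2 UNIV" "s \<in> l2 UNIV"
        using u v s assms l2_imp_UNIV l2_closure_subset by blast+
      from l2_dist_triangle [OF this] have "l2_norm (\<lambda>x. u x - s x) < \<epsilon>"
        using v s by simp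
      then show ?thesis
        using s by blast
    qed
    then show "u \<in> l2_closure E S"
      using u unfolding l2_closure_def by auto
  qed
qed

lemma l2_subspace_closure:
  assumes S: "l2_subspace E S"
  shows "l2_subspace E (l2_closure E S)"
  unfolding l2_subspace_def
proof (intro conjI ballI allI)
  show "l2_closure E S \<subseteq> l2 E"
    by (rule l2_closure_subset)
  show "(\<lambda>_. 0) \<in> l2_closure E S"
    using l2_closure_superset l2_subspaceD [OF S] by blast
next
  fix u v assume uv: "u \<in> l2_closure E S" "v \<in> l2_closure E S"
  then have l2: "u \<in> l2 E" "v \<in> l2 E"
    using l2_closure_subset by auto
  have "\<exists>s\<in>S. l2_norm (\<lambda>x. (u x + v x) - s x) < \<epsilon>" if e: "\<epsilon> > 0" for \<epsilon>
  proof -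
    obtain s t where st: "s \<in> S" "l2_norm (\<lambda>x. u x - s x) < \<epsilon> / 2" "t \<in> S" "l2_norm (\<lambda>x. v x - t x) < \<epsilon> / 2"
      using l2_closureE [OF uv(1) half_gt_zero [OF e]] l2_closureE [OF uv(2) half_gt_zero [OF e]] by metis
    have "l2_norm (\<lambda>x. (u x - s x) + (v x - t x)) \<le> l2_norm (\<lambda>x. u x - s x) + l2_norm (\<lambda>x. v x - t x)"
      using l2 st l2_subspaceD(2) [OF S] by (intro l2_norm_triangle l2_diff) (auto dest: l2_imp_UNIV)
    then have "l2_norm (\<lambda>x. (u x + v x) - (s x + t x)) < \<epsilon>"
      using st by (simp add: algebra_simps)
    then show ?thesis
      using l2_subspaceD(4) [OF S st(1,3)] by (rule bexI [where x = "\<lambda>x. s x + t x"])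
  qed
  then show "(\<lambda>x. u x + v x) \<in> l2_closure E S"
    using l2_add [OF l2] unfolding l2_closure_def by simp
next
  fix c u assume u: "u \<in> l2_closure E S"
  have "\<exists>s\<in>S. l2_norm (\<lambda>x. c * u x - s x) < \<epsilon>" if e: "\<epsilon> > 0" for \<epsilon>
  proof -
    \<comment> \<open>The summand 1 keeps the denominator positive when
      \<open>c = 0\<close>.\<close>
    have "\<epsilon> / (cmod c + 1) > 0"
      using e by (simp add: add_nonneg_pos)
    from l2_closureE [OF u this] obtain s
      where s: "s \<in> S" "l2_norm (\<lambda>x. u x - s x) < \<epsilon> / (cmod c + 1)" .
    have "l2_norm (\<lambda>x. c * u x - c * s x) = cmod c * l2_norm (\<lambda>x. u x - s x)"
      unfolding l2_norm_scale [symmetric] by (simp add: right_diff_distrib)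
    also have "\<dots> \<le> (cmod c + 1) * l2_norm (\<lambda>x. u x - s x)"
      by (intro mult_right_mono) auto
    also have "\<dots> < \<epsilon>"
      using s(2) by (simp add: pos_less_divide_eq add_nonneg_pos mult.commute)
    finally show ?thesis
      using l2_subspaceD(5) [OF S s(1)] by (rule bexI [where x = "\<lambda>x. c * s x"])
  qed
  then show "(\<lambda>x. c * u x) \<in> l2_closure E S"
    using l2_scale [of u E c] u unfolding l2_closure_def by simp
qed

section \<open>Orthogonal complements, completeness and projections\<close>

lemma l2_subspace_perp:
  assumes "S \<subseteq> l2 E"
  shows "l2_subspace E (l2_perp E S)"
proof -
  have S: "s \<in> l2 UNIV" if "s \<in> S" for s
    using that assms l2_imp_UNIV by blast
  show ?thesis
    unfolding l2_subspace_def l2_perp_def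
    by (auto simp: l2_zero l2_add l2_scale l2_inner_scale_left
        l2_inner_add_left [OF l2_imp_UNIV l2_imp_UNIV S])
qed

lemma l2_perp_antimono: "S \<subseteq> T \<Longrightarrow> l2_perp E T \<subseteq> l2_perp E S"
  unfolding l2_perp_def by blast

lemma l2_perp_subset: "l2_perp E S \<subseteq> l2 E"
  unfolding l2_perp_def by blast

lemma l2_perp_perp_superset: "S \<subseteq> l2 E \<Longrightarrow> S \<subseteq> l2_perp E (l2_perp E S)"
proof
  fix s assume "S \<subseteq> l2 E" "s \<in> S"
  moreover have "l2_inner s w = 0" if "w \<in> l2_perp E S" for w
    using that \<open>s \<in> S\<close> l2_inner_commute [of s w] by (simp add: l2_perp_def)
  ultimately show "s \<in> l2_perp E (l2_perp E S)"
    by (auto simp: l2_perp_def [of E "l2_perp E S"])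
qed

text \<open>Complements are closed because, by Cauchy-Schwarz, the inner product with a fixed vector
  is continuous.\<close>

lemma l2_closure_perp:
  assumes S: "S \<subseteq> l2 E"
  shows "l2_closure E (l2_perp E S) = l2_perp E S"
proof
  show "l2_perp E S \<subseteq> l2_closure E (l2_perp E S)"
    by (intro l2_closure_superset l2_perp_subset)
  show "l2_closure E (l2_perp E S) \<subseteq> l2_perp E S"
  proof
    fix u assume u: "u \<in> l2_closure E (l2_perp E S)"
    have "l2_inner u s = 0" if s: "s \<in> S" for s
    proof -
      have "cmod (l2_inner u s) \<le> 0 + \<epsilon>" if e: "\<epsilon> > 0" for \<epsilon>
      proof -
        have "\<epsilon> / (l2_norm s + 1) > 0"
          using e by (simp add: add_nonneg_pos)
        from l2_closureE [OF u this] obtain w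
          where w: "w \<in> l2_perp E S" "l2_norm (\<lambda>x. u x - w x) < \<epsilon> / (l2_norm s + 1)" .
        have l2: "u \<in> l2 UNIV" "w \<in> l2 UNIV" "s \<in> l2 UNIV"
          using u w s S l2_closure_subset l2_perp_subset l2_imp_UNIV by blast+
        have "l2_inner u s = l2_inner (\<lambda>x. u x - w x) s"
          using l2_inner_diff_left [OF l2] w s unfolding l2_perp_def by simp
        then have "cmod (l2_inner u s) \<le> l2_norm (\<lambda>x. u x - w x) * l2_norm s"
          using l2_Cauchy_Schwarz [OF l2_diff [OF l2(1,2)] l2(3)] by simp
        also have "\<dots> \<le> l2_norm (\<lambda>x. u x - w x) * (l2_norm s + 1)"
          by (intro mult_left_mono) auto
        also have "\<dots> < \<epsilon>"
          using w(2) by (simp add: pos_less_divide_eq add_nonneg_pos)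
        finally show ?thesis by simp
      qed
      then have "cmod (l2_inner u s) \<le> 0"
        by (rule field_le_epsilon)
      then show ?thesis by simp
    qed
    then show "u \<in> l2_perp E S"
      using u unfolding l2_closure_def l2_perp_def by simp
  qed
qed

text \<open>Completeness with a rate. Coordinates are dominated by the norm, so a pointwise limit
  exists; on a finite set of coordinates the estimate survives letting \<open>l\<close> tend to
  infinity, which removes \<open>b l\<close>.\<close>

lemma l2_Cauchy_limit:
  fixes h :: "nat \<Rightarrow> 'c \<Rightarrow> complex"
  assumes h: "\<And>m. h m \<in> l2 E"
    and cau: "\<And>m l. (l2_norm (\<lambda>x. h m x - h l x))\<^sup>2 \<le> b m + b l" and b: "b \<longlonglongrightarrow> 0"
  obtains g where "g \<in> l2 E" "\<And>m. (l2_norm (\<lambda>x. h m x - g x))\<^sup>2 \<le> b m"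
proof -
  have hU: "h m \<in> l2 UNIV" for m
    using h l2_imp_UNIV by blast
  have "Cauchy (\<lambda>m. h m x)" for x
  proof (rule CauchyI)
    fix e :: real assume e: "e > 0"
    then have "eventually (\<lambda>m. b m < e\<^sup>2 / 2) sequentially"
      using order_tendstoD(2) [OF b, of "e\<^sup>2 / 2"] by simp
    then obtain M where M: "b m < e\<^sup>2 / 2" if "m \<ge> M" for m
      unfolding eventually_sequentially by blast
    show "\<exists>M. \<forall>m\<ge>M. \<forall>l\<ge>M. norm (h m x - h l x) < e"
    proof (intro exI allI impI)
      fix m l assume "m \<ge> M" "l \<ge> M"
      have "norm (h m x - h l x) \<le> l2_norm (\<lambda>x. h m x - h l x)"
        using l2_norm_ge_component [OF l2_diff [OF hU hU]] .
      then have "(norm (h m x - h l x))\<^sup>2 \<le> (l2_norm (\<lambda>x. h m x - h l x))\<^sup>2"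
        by (intro power_mono) auto
      also have "\<dots> < e\<^sup>2"
        using cau [of m l] M [OF \<open>m \<ge> M\<close>] M [OF \<open>l \<ge> M\<close>] by simp
      finally show "norm (h m x - h l x) < e"
        using e by (simp add: power_less_imp_less_base)
    qed
  qed
  then have "\<exists>g. \<forall>x. (\<lambda>m. h m x) \<longlonglongrightarrow> g x"
    by (intro choice allI) (simp add: Cauchy_convergent_iff convergent_def)
  then obtain g where g: "\<And>x. (\<lambda>m. h m x) \<longlonglongrightarrow> g x"
    by blast
  have g0: "g x = 0" if "x \<notin> E" for x
  proof -
    have "h m x = 0" for m
      using h [of m] that by (simp add: l2_def)
    then show ?thesis
      using LIMSEQ_unique [OF g [of x], of 0] by simp
  qed
  have sums: "(\<Sum>x\<in>F. (cmod (h m x - g x))\<^sup>2) \<le> b m" if "finite F" for F m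
  proof -
    have "(\<lambda>l. \<Sum>x\<in>F. (cmod (h m x - h l x))\<^sup>2) \<longlonglongrightarrow> (\<Sum>x\<in>F. (cmod (h m x - g x))\<^sup>2)"
      by (intro tendsto_intros g)
    moreover have "(\<lambda>l. b m + b l) \<longlonglongrightarrow> b m + 0"
      by (intro tendsto_intros b)
    moreover have "(\<Sum>x\<in>F. (cmod (h m x - h l x))\<^sup>2) \<le> b m + b l" for l
      using l2_sum_le_norm_square [OF l2_diff [OF hU hU] that] cau by (rule order_trans)
    ultimately have "(\<Sum>x\<in>F. (cmod (h m x - g x))\<^sup>2) \<le> b m + 0"
      by (intro LIMSEQ_le) blast+
    then show ?thesis by simp
  qed
  have hg: "(\<lambda>x. h m x - g x) \<in> l2 E" "(l2_norm (\<lambda>x. h m x - g x))\<^sup>2 \<le> b m" for m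
    using l2_of_bounded_sums [of E "\<lambda>x. h m x - g x" "b m"] sums g0 h [of m]
    by (auto simp: l2_def)
  have "g \<in> l2 E"
    using l2_diff [OF h [of 0] hg(1) [of 0]] by simp
  then show thesis
    using that hg(2) by blast
qed

lemma l2_parallelogram:
  assumes "u \<in> l2 UNIV" "v \<in> l2 UNIV"
  shows "(l2_norm (\<lambda>x. u x - v x))\<^sup>2 = 2 * (l2_norm u)\<^sup>2 + 2 * (l2_norm v)\<^sup>2 - (l2_norm (\<lambda>x. u x + v x))\<^sup>2"
  using l2_norm_diff_scale_square [OF assms, of 1] l2_norm_add_square [OF assms] by simp

text \<open>A minimizing sequence for the distance to the subspace is a Cauchy sequence by the
  parallelogram law.\<close>

lemma l2_projection_exists:
  assumes H: "l2_subspace E H" and closed: "l2_closure E H \<subseteq> H" and u: "u \<in> l2 E"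
  obtains v where "v \<in> H" "(\<lambda>x. u x - v x) \<in> l2_perp E H"
proof -
  note HU = l2_subspaceD(2) [OF H] and uU = l2_imp_UNIV [OF u]
  define N where "N h = (l2_norm (\<lambda>x. u x - h x))\<^sup>2" for h
  define d where "d = Inf (N ` H)"
  have bdd: "bdd_below (N ` H)"
    by (rule bdd_belowI2 [where m = 0]) (simp add: N_def)
  have d_le: "d \<le> N h" if "h \<in> H" for h
    unfolding d_def using bdd that by (intro cInf_lower) auto
  have "N ` H \<noteq> {}"
    using l2_subspaceD(3) [OF H] by blast
  then have "\<exists>h\<in>H. N h < d + 1 / real (Suc m)" for m
    using cInf_lessD [of "N ` H" "d + 1 / real (Suc m)"] unfolding d_def by simp
  then obtain h where h: "\<And>m. h m \<in> H" "\<And>m. N (h m) < d + 1 / real (Suc m)"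
    by metis
  \<comment> \<open>Twice the excess of \<open>N (h m)\<close> over \<open>d\<close>: the
    parallelogram law bounds the squared distance by
    \<open>2 * N (h l) + 2 * N (h m) - 4 * d\<close>.\<close>
  define b where "b m = 2 / real (Suc m)" for m
  have b: "b \<longlonglongrightarrow> 0"
    unfolding b_def using LIMSEQ_inverse_real_of_nat
    by (auto simp: divide_inverse intro: tendsto_mult_right_zero)
  have "(l2_norm (\<lambda>x. h m x - h l x))\<^sup>2 \<le> b m + b l" for m l
  proof -
    let ?mid = "\<lambda>x. (1/2) * (h m x + h l x)"
    have mid: "?mid \<in> H"
      by (intro l2_subspaceD(4,5) [OF H] h)
    have "(l2_norm (\<lambda>x. (u x - h m x) + (u x - h l x)))\<^sup>2 = 4 * N ?mid"
    proof -
      have "l2_norm (\<lambda>x. (u x - h m x) + (u x - h l x)) = l2_norm (\<lambda>x. 2 * (u x - ?mid x))"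
        by (rule arg_cong [of _ _ l2_norm]) (auto simp: algebra_simps)
      then show ?thesis
        unfolding N_def l2_norm_scale by (simp add: power_mult_distrib)
    qed
    moreover have "(l2_norm (\<lambda>x. h m x - h l x))\<^sup>2 = (l2_norm (\<lambda>x. (u x - h l x) - (u x - h m x)))\<^sup>2"
      by simp
    ultimately have "(l2_norm (\<lambda>x. h m x - h l x))\<^sup>2 = 2 * N (h l) + 2 * N (h m) - 4 * N ?mid"
      using l2_parallelogram [OF l2_diff [OF uU HU [OF h(1) [of l]]] l2_diff [OF uU HU [OF h(1) [of m]]]]
      by (simp add: N_def add.commute)
    then show ?thesis
      using d_le [OF mid] h(2) [of m] h(2) [of l] by (simp add: b_def)
  qed
  from l2_Cauchy_limit [OF l2_subspaceD(1) [OF H h(1)] this b] obtain g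
    where g: "g \<in> l2 E" "\<And>m. (l2_norm (\<lambda>x. h m x - g x))\<^sup>2 \<le> b m"
    by blast
  have dist: "l2_norm (\<lambda>x. h m x - g x) \<le> sqrt (b m)" for m
    using g(2) [of m] by (simp add: real_le_rsqrt)
  have sqrt_b: "(\<lambda>m. sqrt (b m)) \<longlonglongrightarrow> 0"
    using tendsto_real_sqrt [OF b] by simp
  have gU: "g \<in> l2 UNIV"
    using g(1) by (rule l2_imp_UNIV)
  have "\<exists>s\<in>H. l2_norm (\<lambda>x. g x - s x) < \<epsilon>" if "\<epsilon> > 0" for \<epsilon>
  proof -
    obtain m where "sqrt (b m) < \<epsilon>"
      using order_tendstoD(2) [OF sqrt_b \<open>\<epsilon> > 0\<close>] eventually_sequentially by auto
    then have "l2_norm (\<lambda>x. g x - h m x) < \<epsilon>"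
      using dist [of m] by (simp add: l2_norm_minus_commute)
    then show ?thesis
      using h(1) by blast
  qed
  then have gH: "g \<in> H"
    using closed g(1) by (auto simp: l2_closure_def)
  have "l2_norm (\<lambda>x. u x - g x) \<le> sqrt (d + 1 / real (Suc m)) + sqrt (b m)" for m
  proof -
    have "l2_norm (\<lambda>x. u x - g x) \<le> l2_norm (\<lambda>x. u x - h m x) + l2_norm (\<lambda>x. h m x - g x)"
      by (rule l2_dist_triangle [OF uU HU [OF h(1)] gU])
    moreover have "l2_norm (\<lambda>x. u x - h m x) \<le> sqrt (d + 1 / real (Suc m))"
      using h(2) [of m] by (simp add: N_def real_le_rsqrt)
    ultimately show ?thesis
      using dist [of m] by linarith
  qed
  moreover have "(\<lambda>m. sqrt (d + 1 / real (Suc m)) + sqrt (b m)) \<longlonglongrightarrow> sqrt (d + 0) + 0"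
    using LIMSEQ_inverse_real_of_nat by (intro tendsto_intros sqrt_b) (simp add: divide_inverse)
  ultimately have "l2_norm (\<lambda>x. u x - g x) \<le> sqrt d"
    using LIMSEQ_le_const by fastforce
  moreover have "d \<ge> 0"
    unfolding d_def using \<open>N ` H \<noteq> {}\<close> by (intro cInf_greatest) (auto simp: N_def)
  ultimately have Ng: "N g \<le> d"
    unfolding N_def using power_mono [of "l2_norm (\<lambda>x. u x - g x)" "sqrt d" 2] by simp
  have "l2_inner (\<lambda>x. u x - g x) s = 0" if s: "s \<in> H" for s
  proof (rule ccontr)
    define a where "a = l2_inner (\<lambda>x. u x - g x) s"
    define r where "r = (l2_norm s)\<^sup>2"
    assume "l2_inner (\<lambda>x. u x - g x) s \<noteq> 0"
    then have a: "cmod a > 0"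
      by (simp add: a_def)
    have r: "r \<ge> 0"
      by (simp add: r_def)
    \<comment> \<open>Moving \<open>g\<close> by \<open>e * a * s\<close> lowers the distance to
      first order in \<open>e\<close>; this size gives \<open>e * r \<le> 1\<close>, so the
      second-order term cannot compensate.\<close>
    define e where "e = 1 / (r + 1)"
    have "N g \<le> N (\<lambda>x. g x + (e * a) * s x)"
      using Ng d_le [OF l2_subspaceD(4) [OF H gH l2_subspaceD(5) [OF H s]]] by (rule order_trans)
    also have "\<dots> = N g - 2 * Re (cnj (e * a) * a) + (cmod (e * a))\<^sup>2 * r"
      using l2_norm_diff_scale_square [OF l2_diff [OF uU gU] HU [OF s], of "e * a"]
      by (simp add: N_def a_def r_def algebra_simps)
    also have "cnj (e * a) * a = complex_of_real (e * (cmod a)\<^sup>2)"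
      unfolding of_real_mult complex_norm_square by (simp add: mult.commute mult.left_commute)
    finally have "2 * (e * (cmod a)\<^sup>2) \<le> e\<^sup>2 * (cmod a)\<^sup>2 * r"
      by (simp add: norm_mult power_mult_distrib)
    then have "2 * e \<le> e\<^sup>2 * r"
      using a by (simp add: field_simps)
    moreover have "e > 0" "e * r \<le> 1"
      using r by (simp_all add: e_def)
    ultimately show False
      by (simp add: power2_eq_square mult.assoc)
  qed
  then have "(\<lambda>x. u x - g x) \<in> l2_perp E H"
    using l2_diff [OF u g(1)] by (simp add: l2_perp_def)
  with gH that show thesis by blast
qed

lemma l2_perp_self_eq_0:
  assumes "u \<in> S" "u \<in> l2_perp E S"
  shows "u = (\<lambda>_. 0)"
proof -
  have "u \<in> l2 UNIV" "l2_inner u u = 0"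
    using assms by (auto simp: l2_perp_def dest: l2_imp_UNIV)
  then show ?thesis
    using l2_norm_eq_0 by (simp add: l2_inner_self)
qed

text \<open>For \<open>u\<close> in the double complement, its residual modulo the closure lies in
  both the complement and the double complement, hence vanishes.\<close>

lemma l2_perp_perp:
  assumes S: "l2_subspace E S"
  shows "l2_perp E (l2_perp E S) = l2_closure E S"
proof
  have sub: "S \<subseteq> l2 E"
    using S by (simp add: l2_subspace_def)
  show cl: "l2_closure E S \<subseteq> l2_perp E (l2_perp E S)"
    using l2_closure_mono [OF l2_perp_perp_superset [OF sub]] l2_closure_perp [OF l2_perp_subset] by blast
  show "l2_perp E (l2_perp E S) \<subseteq> l2_closure E S"
  proof
    fix u assume u: "u \<in> l2_perp E (l2_perp E S)"
    have "u \<in> l2 E"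
      using u l2_perp_subset by blast
    from l2_projection_exists [OF l2_subspace_closure [OF S] _ this] obtain v
      where v: "v \<in> l2_closure E S" "(\<lambda>x. u x - v x) \<in> l2_perp E (l2_closure E S)"
      using l2_closure_idem [OF sub] by blast
    have "(\<lambda>x. u x - v x) \<in> l2_perp E S"
      using v(2) l2_perp_antimono [OF l2_closure_superset [OF sub]] by blast
    moreover have "(\<lambda>x. u x - v x) \<in> l2_perp E (l2_perp E S)"
      using l2_subspace_diff [OF l2_subspace_perp [OF l2_perp_subset] u] cl v(1) by blast
    ultimately have "(\<lambda>x. u x - v x) = (\<lambda>_. 0)"
      by (rule l2_perp_self_eq_0)
    then have "u = v"
      by (simp add: fun_eq_iff)
    with v show "u \<in> l2_closure E S" by simp
  qed
qed

text \<open>The nontrivial inclusion is that a complement lies in its own double complement, the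
  closure being the double complement of \<open>S\<close>.\<close>

lemma l2_perp_closure:
  assumes S: "l2_subspace E S"
  shows "l2_perp E (l2_closure E S) = l2_perp E S"
proof
  have sub: "S \<subseteq> l2 E"
    using S by (simp add: l2_subspace_def)
  show "l2_perp E (l2_closure E S) \<subseteq> l2_perp E S"
    by (intro l2_perp_antimono l2_closure_superset sub)
  show "l2_perp E S \<subseteq> l2_perp E (l2_closure E S)"
    unfolding l2_perp_perp [OF S, symmetric] by (intro l2_perp_perp_superset l2_perp_subset)
qed

section \<open>Determinantal measures\<close>

definition closed_l2_subspace :: "'c set \<Rightarrow> ('c \<Rightarrow> complex) set \<Rightarrow> bool" where
  "closed_l2_subspace E H \<longleftrightarrow> l2_subspace E H \<and> l2_closure E H \<subseteq> H"

lemma l2_proj: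
  assumes "closed_l2_subspace E H" "u \<in> l2 E"
  shows "l2_proj E H u \<in> H" "(\<lambda>x. u x - l2_proj E H u x) \<in> l2_perp E H"
proof -
  have H: "l2_subspace E H"
    using assms by (simp add: closed_l2_subspace_def)
  then have sub: "H \<subseteq> l2 E"
    by (simp add: l2_subspace_def)
  have "\<exists>!v. v \<in> H \<and> (\<lambda>x. u x - v x) \<in> l2_perp E H"
  proof (rule ex_ex1I)
    show "\<exists>v. v \<in> H \<and> (\<lambda>x. u x - v x) \<in> l2_perp E H"
      using l2_projection_exists [of E H u] assms by (auto simp: closed_l2_subspace_def)
    fix v w
    assume v: "v \<in> H \<and> (\<lambda>x. u x - v x) \<in> l2_perp E H"
      and w: "w \<in> H \<and> (\<lambda>x. u x - w x) \<in> l2_perp E H"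
    have "(\<lambda>x. (u x - w x) - (u x - v x)) \<in> l2_perp E H"
      using l2_subspace_diff [OF l2_subspace_perp [OF sub]] v w by blast
    then have "(\<lambda>x. v x - w x) \<in> l2_perp E H"
      by simp
    then have "(\<lambda>x. v x - w x) = (\<lambda>_. 0)"
      using l2_subspace_diff [OF H] v w by (intro l2_perp_self_eq_0) auto
    then show "v = w"
      by (simp add: fun_eq_iff)
  qed
  from theI' [OF this] show "l2_proj E H u \<in> H" "(\<lambda>x. u x - l2_proj E H u x) \<in> l2_perp E H"
    unfolding l2_proj_def by auto
qed

lemma l2_point: "e \<in> E \<Longrightarrow> (\<lambda>x. of_bool (x = e)) \<in> l2 E"
  by (rule l2_of_finite_support) (auto simp: of_bool_def)

lemma l2_inner_point: "l2_inner u (\<lambda>x. of_bool (x = e)) = u e"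
proof -
  have "l2_inner u (\<lambda>x. of_bool (x = e)) = (\<Sum>\<^sub>\<infinity>x\<in>{e}. u x)"
    unfolding l2_inner_def by (rule infsum_cong_neutral) auto
  then show ?thesis by simp
qed

text \<open>The residual of the basis vector is orthogonal to its projection, so pairing the
  projection with the basis vector or with itself is the same.\<close>

lemma proj_matrix_diagonal:
  assumes H: "closed_l2_subspace E H" and e: "e \<in> E"
  shows "proj_matrix E H e e = complex_of_real ((l2_norm (l2_proj E H (\<lambda>x. of_bool (x = e))))\<^sup>2)"
proof -
  let ?\<delta> = "\<lambda>x. of_bool (x = e) :: complex"
  let ?p = "l2_proj E H ?\<delta>"
  note p = l2_proj [OF H l2_point [OF e]]
  have l2: "?p \<in> l2 UNIV" "?\<delta> \<in> l2 UNIV"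
    using p(1) H l2_point [OF e] l2_subspaceD(2) [of E H] l2_imp_UNIV unfolding closed_l2_subspace_def by blast+
  have "l2_inner (\<lambda>x. ?\<delta> x - ?p x) ?p = 0"
    using p unfolding l2_perp_def by blast
  then have "l2_inner ?p (\<lambda>x. ?\<delta> x - ?p x) = 0"
    using l2_inner_commute [of ?p "\<lambda>x. ?\<delta> x - ?p x"] by simp
  then have "l2_inner ?p ?\<delta> = l2_inner ?p ?p"
    unfolding l2_inner_diff_right [OF l2(2,1,1)] by simp
  then show ?thesis
    unfolding proj_matrix_def l2_inner_self [OF l2(1)] by simp
qed

text \<open>The difference of the two projections is a positive operator, and it vanishes as its diagonal does.\<close>

lemma closed_l2_subspace_eq_of_diagonal:
  assumes H: "closed_l2_subspace E H" and K: "closed_l2_subspace E K" and "H \<subseteq> K"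
    and diag: "\<And>e. e \<in> E \<Longrightarrow> proj_matrix E H e e = proj_matrix E K e e"
  shows "H = K"
proof
  have Hs: "l2_subspace E H" and Ks: "l2_subspace E K" and sub: "H \<subseteq> l2 E" "K \<subseteq> l2 E"
    using H K by (auto simp: closed_l2_subspace_def l2_subspace_def)
  have proj_eq: "l2_proj E H (\<lambda>x. of_bool (x = e)) = l2_proj E K (\<lambda>x. of_bool (x = e))" if e: "e \<in> E" for e
  proof -
    let ?\<delta> = "\<lambda>x. of_bool (x = e) :: complex"
    define p where "p = l2_proj E H ?\<delta>"
    define q where "q = l2_proj E K ?\<delta>"
    note pH = l2_proj [OF H l2_point [OF e], folded p_def]
    note qK = l2_proj [OF K l2_point [OF e], folded q_def]
    have l2: "p \<in> l2 UNIV" "q \<in> l2 UNIV"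
      using pH(1) qK(1) sub l2_imp_UNIV by blast+
    have "(\<lambda>x. ?\<delta> x - q x) \<in> l2_perp E H"
      using qK(2) l2_perp_antimono [OF \<open>H \<subseteq> K\<close>] by blast
    with pH(2) have "(\<lambda>x. (?\<delta> x - p x) - (?\<delta> x - q x)) \<in> l2_perp E H"
      by (rule l2_subspace_diff [OF l2_subspace_perp [OF sub(1)]])
    then have "(\<lambda>x. q x - p x) \<in> l2_perp E H"
      by simp
    then have orth: "l2_inner (\<lambda>x. q x - p x) p = 0"
      using pH(1) unfolding l2_perp_def by blast
    have "(l2_norm p)\<^sup>2 = (l2_norm q)\<^sup>2"
      using diag [OF e] proj_matrix_diagonal [OF H e] proj_matrix_diagonal [OF K e]
      unfolding p_def q_def by (metis of_real_eq_iff)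
    \<comment> \<open>Pythagoras for the orthogonal summands \<open>q - p\<close> and
      \<open>p\<close>; equal diagonals leave no room for the first.\<close>
    moreover have "(l2_norm q)\<^sup>2 = (l2_norm (\<lambda>x. q x - p x))\<^sup>2 + (l2_norm p)\<^sup>2"
      using l2_norm_add_square [OF l2_diff [OF l2(2,1)] l2(1)] orth by simp
    ultimately have "l2_norm (\<lambda>x. q x - p x) = 0"
      by simp
    then have "(\<lambda>x. q x - p x) = (\<lambda>_. 0)"
      by (intro l2_norm_eq_0 l2_diff l2)
    then show ?thesis
      unfolding p_def q_def by (simp add: fun_eq_iff)
  qed
  show "K \<subseteq> H"
  proof
    fix h assume h: "h \<in> K"
    define g where "g = l2_proj E H h"
    have hE: "h \<in> l2 E"
      using h sub by blast
    note gH = l2_proj [OF H hE, folded g_def]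
    \<comment> \<open>The residual is in \<open>K\<close> and orthogonal to \<open>H\<close>. Its
      coordinate at \<open>e\<close> is its inner product with the projection of the basis vector to
      \<open>K\<close>, and that projection lies in \<open>H\<close> by
      \<open>proj_eq\<close>.\<close>
    define w where "w = (\<lambda>x. h x - g x)"
    have wK: "w \<in> K"
      unfolding w_def using gH(1) \<open>H \<subseteq> K\<close> by (intro l2_subspace_diff [OF Ks h]) auto
    then have wE: "w \<in> l2 E" and wU: "w \<in> l2 UNIV"
      using sub l2_imp_UNIV by blast+
    have "w e = 0" for e
    proof (cases "e \<in> E")
      case True
      let ?\<delta> = "\<lambda>x. of_bool (x = e) :: complex"
      define q where "q = l2_proj E K ?\<delta>"
      note qK = l2_proj [OF K l2_point [OF True], folded q_def]
      have l2: "q \<in> l2 UNIV" "?\<delta> \<in> l2 UNIV"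
        using qK(1) sub l2_point [OF True] l2_imp_UNIV by blast+
      have "l2_inner (\<lambda>x. ?\<delta> x - q x) w = 0"
        using qK(2) wK unfolding l2_perp_def by blast
      then have "l2_inner w (\<lambda>x. ?\<delta> x - q x) = 0"
        using l2_inner_commute [of w "\<lambda>x. ?\<delta> x - q x"] by simp
      moreover have "q \<in> H"
        using l2_proj(1) [OF H l2_point [OF True]] proj_eq [OF True] by (simp add: q_def)
      then have "l2_inner w q = 0"
        using gH(2) unfolding w_def l2_perp_def by blast
      ultimately show ?thesis
        using l2_inner_diff_right [OF l2(2,1) wU] l2_inner_point [of w e] by simp
    qed (use wE in \<open>simp add: l2_def\<close>)
    then have "h = g"
      by (simp add: w_def fun_eq_iff)
    with gH(1) show "h \<in> H" by simp
  qed
qed (rule \<open>H \<subseteq> K\<close>)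

text \<open>The events \<open>D \<subseteq> F\<close> generate the same sets as the one-point
  events, are closed under intersection, and are those whose probabilities the determinants
  prescribe.\<close>

lemma sets_subset_algebra:
  "sets (subset_algebra E) = sigma_sets (Pow E) {{F \<in> Pow E. D \<subseteq> F} | D. finite D \<and> D \<subseteq> E}"
proof -
  let ?A = "{{F \<in> Pow E. e \<in> F} | e. e \<in> E}"
  let ?B = "{{F \<in> Pow E. D \<subseteq> F} | D. finite D \<and> D \<subseteq> E}"
  interpret sigma_algebra "Pow E" "sigma_sets (Pow E) ?A"
    by (rule sigma_algebra_sigma_sets) auto
  have B: "{F \<in> Pow E. D \<subseteq> F} \<in> sigma_sets (Pow E) ?A" if "finite D" "D \<subseteq> E" for D
    using that
  proof (induction D rule: finite_induct)
    case empty
    then show ?case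
      using top by (simp add: Pow_def)
  next
    case (insert e D)
    have "{F \<in> Pow E. insert e D \<subseteq> F} = {F \<in> Pow E. e \<in> F} \<inter> {F \<in> Pow E. D \<subseteq> F}"
      by auto
    moreover have "{F \<in> Pow E. e \<in> F} \<in> sigma_sets (Pow E) ?A"
      using insert.prems by (intro sigma_sets.Basic) auto
    moreover have "{F \<in> Pow E. D \<subseteq> F} \<in> sigma_sets (Pow E) ?A"
      using insert.IH insert.prems by simp
    ultimately show ?case
      using Int by simp
  qed
  have AB: "?A \<subseteq> ?B"
  proof clarify
    fix e assume "e \<in> E"
    then show "\<exists>D. {F \<in> Pow E. e \<in> F} = {F \<in> Pow E. D \<subseteq> F} \<and> finite D \<and> D \<subseteq> E"
      by (intro exI [of _ "{e}"]) auto
  qed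
  have "sigma_sets (Pow E) ?A = sigma_sets (Pow E) ?B"
  proof (rule sigma_sets_eqI)
    show "a \<in> sigma_sets (Pow E) ?B" if "a \<in> ?A" for a
      using that AB by (intro sigma_sets.Basic) (rule subsetD)
    show "b \<in> sigma_sets (Pow E) ?A" if "b \<in> ?B" for b
      using that B by blast
  qed
  moreover have "?A \<subseteq> Pow (Pow E)"
    by auto
  ultimately show ?thesis
    by (simp add: subset_algebra_def)
qed

lemma space_determinantal_measure:
  assumes "determinantal_measure E H P"
  shows "space P = Pow E"
proof -
  have "space P = space (subset_algebra E)"
    using assms by (intro sets_eq_imp_space_eq) (simp add: determinantal_measure_def)
  then show ?thesis
    unfolding subset_algebra_def space_measure_of_conv .
qed

text \<open>Two finite measures agreeing on an intersection-stable generator coincide; the whole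
  space is the generator with \<open>D = {}\<close>.\<close>

lemma determinantal_measure_unique:
  assumes P: "determinantal_measure E H P" and Q: "determinantal_measure E H Q"
  shows "P = Q"
proof -
  let ?B = "{{F \<in> Pow E. D \<subseteq> F} | D. finite D \<and> D \<subseteq> E}"
  interpret P: prob_space P using P by (simp add: determinantal_measure_def)
  interpret Q: prob_space Q using Q by (simp add: determinantal_measure_def)
  show ?thesis
  proof (rule measure_eqI_generator_eq [where E = ?B and \<Omega> = "Pow E" and A = "\<lambda>_. Pow E"])
    show "Int_stable ?B"
    proof (rule Int_stableI, clarify)
      fix C D assume "finite C" "C \<subseteq> E" "finite D" "D \<subseteq> E"
      then show "\<exists>D'. {F \<in> Pow E. C \<subseteq> F} \<inter> {F \<in> Pow E. D \<subseteq> F} = {F \<in> Pow E. D' \<subseteq> F} \<and> finite D' \<and> D' \<subseteq> E"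
        by (intro exI [of _ "C \<union> D"]) auto
    qed
    show "sets P = sigma_sets (Pow E) ?B" "sets Q = sigma_sets (Pow E) ?B"
      using P Q by (simp_all add: determinantal_measure_def sets_subset_algebra)
    show "emeasure P Y = emeasure Q Y" if Y: "Y \<in> ?B" for Y
    proof -
      obtain D where D: "Y = {F \<in> Pow E. D \<subseteq> F}" "finite D" "D \<subseteq> E"
        using Y by blast
      have "complex_of_real (measure P Y) = complex_of_real (measure Q Y)"
        using P Q D space_determinantal_measure [OF P] space_determinantal_measure [OF Q]
        unfolding determinantal_measure_def by simp
      then show ?thesis
        by (simp add: P.emeasure_eq_measure Q.emeasure_eq_measure)
    qed
    show "range (\<lambda>_. Pow E) \<subseteq> ?B"
      by (auto intro!: exI [of _ "{}"])
    show "emeasure P (Pow E) \<noteq> \<infinity>"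
      by simp
  qed auto
qed

lemma determinantal_measure_diagonal:
  assumes P: "determinantal_measure E H P" and e: "e \<in> E"
  shows "proj_matrix E H e e = complex_of_real (measure P {F \<in> space P. e \<in> F})"
proof -
  have "complex_of_real (measure P {F \<in> space P. {e} \<subseteq> F}) = det_on {e} (proj_matrix E H)"
    using P e unfolding determinantal_measure_def by blast
  also have "\<dots> = proj_matrix E H e e"
  proof -
    have "{p. p permutes {e}} = {id}"
      by (auto simp: permutes_sing)
    then show ?thesis
      by (simp add: det_on_def)
  qed
  finally show ?thesis by simp
qed

text \<open>Without the inclusion the measure need not determine the subspace: in dimension 2 the
  lines spanned by (1,1) and (1,-1) give the same measure.\<close>

lemma determinantal_measure_eq_iff:
  assumes "closed_l2_subspace E H" "closed_l2_subspace E K" "H \<subseteq> K"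
    and "determinantal_measure E H P" "determinantal_measure E K Q"
  shows "P = Q \<longleftrightarrow> H = K"
proof
  assume eq: "P = Q"
  have "proj_matrix E H e e = proj_matrix E K e e" if "e \<in> E" for e
    unfolding determinantal_measure_diagonal [OF assms(4) that]
      determinantal_measure_diagonal [OF assms(5) that] eq ..
  then show "H = K"
    by (rule closed_l2_subspace_eq_of_diagonal [OF assms(1-3)])
next
  assume "H = K"
  then show "P = Q"
    using assms determinantal_measure_unique by blast
qed

section \<open>Locally finite integral matrices\<close>

definition finite_support :: "'c set \<Rightarrow> ('c \<Rightarrow> complex) set" where
  "finite_support E = {u. finite {x. u x \<noteq> 0} \<and> {x. u x \<noteq> 0} \<subseteq> E}"

lemma finite_supportI:
  assumes "finite V" "V \<subseteq> E" "\<And>x. x \<notin> V \<Longrightarrow> u x = 0"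
  shows "u \<in> finite_support E"
proof -
  have "{x. u x \<noteq> 0} \<subseteq> V"
    using assms(3) by blast
  then show ?thesis
    using assms(1,2) finite_subset [of _ V] unfolding finite_support_def by auto
qed

lemma finite_support_subset_l2: "finite_support E \<subseteq> l2 E"
  unfolding finite_support_def using l2_of_finite_support by blast

lemma finite_support_point: "e \<in> E \<Longrightarrow> (\<lambda>x. of_bool (x = e)) \<in> finite_support E"
  by (auto simp: finite_support_def of_bool_def)

lemma l2_subspace_finite_support: "l2_subspace E (finite_support E)"
proof -
  have "(\<lambda>x. u x + v x) \<in> finite_support E" if "u \<in> finite_support E" "v \<in> finite_support E" for u v
    using that by (intro finite_supportI [of "{x. u x \<noteq> 0} \<union> {x. v x \<noteq> 0}"]) (auto simp: finite_support_def)
  moreover have "(\<lambda>x. c * u x) \<in> finite_support E" if "u \<in> finite_support E" for c u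
    using that by (intro finite_supportI [of "{x. u x \<noteq> 0}"]) (auto simp: finite_support_def)
  moreover have "(\<lambda>_. 0) \<in> finite_support E"
    by (simp add: finite_support_def)
  ultimately show ?thesis
    using finite_support_subset_l2 [of E] unfolding l2_subspace_def by simp
qed

lemma l2_perp_finite_support: "l2_perp E (finite_support E) = {\<lambda>_. 0}"
proof -
  have "u e = 0" if "u \<in> l2_perp E (finite_support E)" for u e
  proof (cases "e \<in> E")
    case True
    then show ?thesis
      using that finite_support_point [OF True] l2_inner_point [of u e] unfolding l2_perp_def by auto
  qed (use that in \<open>simp add: l2_perp_def l2_def\<close>)
  then show ?thesis
    by (auto simp: l2_perp_def l2_zero fun_eq_iff)
qed

text \<open>Density through the double complement: pairing with basis vectors reads off coordinates,
  so only 0 is orthogonal to all finitely supported functions.\<close>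

lemma l2_closure_finite_support: "l2_closure E (finite_support E) = l2 E"
  unfolding l2_perp_perp [OF l2_subspace_finite_support, symmetric] l2_perp_finite_support
  by (simp add: l2_perp_def)

lemma l2_inner_finite_support:
  assumes "finite V" "{x. v x \<noteq> 0} \<subseteq> V"
  shows "l2_inner u v = (\<Sum>x\<in>V. u x * cnj (v x))"
proof -
  have "l2_inner u v = (\<Sum>\<^sub>\<infinity>x\<in>V. u x * cnj (v x))"
    unfolding l2_inner_def using assms(2) by (intro infsum_cong_neutral) auto
  then show ?thesis
    using assms(1) by simp
qed

text \<open>The first index of \<open>M\<close> belongs to the source and the second to the target,
  matching \<open>n k a b\<close> for the boundary; the coboundary is the same operator for the
  transposed matrix.\<close>

definition mat_op :: "('c \<Rightarrow> 'c \<Rightarrow> int) \<Rightarrow> 'c set \<Rightarrow> 'c set \<Rightarrow> ('c \<Rightarrow> complex) \<Rightarrow> 'c \<Rightarrow> complex" where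
  "mat_op M A B u = (\<lambda>b. if b \<in> B then \<Sum>\<^sub>\<infinity>a\<in>A. of_int (M a b) * u a else 0)"

text \<open>Finiteness for fixed \<open>b\<close> makes the sums in \<open>mat_op\<close> finite;
  finiteness for fixed \<open>a\<close> preserves finite support.\<close>

definition locally_finite_matrix :: "('c \<Rightarrow> 'c \<Rightarrow> int) \<Rightarrow> 'c set \<Rightarrow> 'c set \<Rightarrow> bool" where
  "locally_finite_matrix M A B \<longleftrightarrow>
     (\<forall>b\<in>B. finite {a \<in> A. M a b \<noteq> 0}) \<and> (\<forall>a\<in>A. finite {b \<in> B. M a b \<noteq> 0})"

lemma locally_finite_matrix_transpose:
  "locally_finite_matrix M A B \<Longrightarrow> locally_finite_matrix (\<lambda>b a. M a b) B A"
  by (simp add: locally_finite_matrix_def)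

text \<open>The condition on the products covers both sources of finiteness, the support of
  \<open>u\<close> and that of the entries at \<open>b\<close>.\<close>

lemma mat_op_finite:
  assumes "finite S" "S \<subseteq> A" "\<And>a. a \<in> A \<Longrightarrow> a \<notin> S \<Longrightarrow> of_int (M a b) * u a = 0" "b \<in> B"
  shows "mat_op M A B u b = (\<Sum>a\<in>S. of_int (M a b) * u a)"
proof -
  have "(\<Sum>\<^sub>\<infinity>a\<in>A. of_int (M a b) * u a) = (\<Sum>\<^sub>\<infinity>a\<in>S. of_int (M a b) * u a)"
    using assms by (intro infsum_cong_neutral) auto
  then show ?thesis
    using assms(1,4) by (simp add: mat_op_def)
qed

lemma mat_op_column:
  assumes "locally_finite_matrix M A B" "b \<in> B"
  shows "mat_op M A B u b = (\<Sum>a | a \<in> A \<and> M a b \<noteq> 0. of_int (M a b) * u a)"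
  using assms by (intro mat_op_finite) (auto simp: locally_finite_matrix_def)

lemma mat_op_add:
  assumes "locally_finite_matrix M A B"
  shows "mat_op M A B (\<lambda>x. u x + v x) = (\<lambda>b. mat_op M A B u b + mat_op M A B v b)"
proof
  fix b
  show "mat_op M A B (\<lambda>x. u x + v x) b = mat_op M A B u b + mat_op M A B v b"
  proof (cases "b \<in> B")
    case True
    then show ?thesis
      by (simp add: mat_op_column [OF assms] distrib_left sum.distrib)
  qed (simp add: mat_op_def)
qed

lemma mat_op_scale: "mat_op M A B (\<lambda>x. c * u x) = (\<lambda>b. c * mat_op M A B u b)"
  by (auto simp: mat_op_def fun_eq_iff mult.left_commute infsum_cmult_right')

lemma mat_op_zero: "mat_op M A B (\<lambda>_. 0) = (\<lambda>_. 0)"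
  by (simp add: mat_op_def fun_eq_iff)

lemma mat_op_diff:
  assumes "locally_finite_matrix M A B"
  shows "mat_op M A B (\<lambda>x. u x - v x) = (\<lambda>b. mat_op M A B u b - mat_op M A B v b)"
  using mat_op_add [OF assms, of u "\<lambda>x. (-1) * v x"] mat_op_scale [of M A B "-1" v] by simp

lemma mat_op_finite_support:
  assumes M: "locally_finite_matrix M A B" and u: "u \<in> finite_support A"
  shows "mat_op M A B u \<in> finite_support B"
proof -
  have "mat_op M A B u b = 0" if "b \<notin> (\<Union>a\<in>{a. u a \<noteq> 0}. {b \<in> B. M a b \<noteq> 0})" for b
  proof (cases "b \<in> B")
    case True
    then have "M a b = 0 \<or> u a = 0" for a
      using that by blast
    then show ?thesis
      unfolding mat_op_column [OF M True] by (intro sum.neutral) (metis mult_eq_0_iff of_int_0)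
  qed (simp add: mat_op_def)
  moreover have "finite (\<Union>a\<in>{a. u a \<noteq> 0}. {b \<in> B. M a b \<noteq> 0})"
    using M u unfolding locally_finite_matrix_def finite_support_def by blast
  ultimately show ?thesis
    by (intro finite_supportI [of "\<Union>a\<in>{a. u a \<noteq> 0}. {b \<in> B. M a b \<noteq> 0}"]) auto
qed

text \<open>Since \<open>v\<close> is finitely supported, both pairings are finite double sums, for
  arbitrary \<open>u\<close>. The entries are real, so no conjugate of \<open>M\<close>
  appears.\<close>

lemma mat_op_adjoint:
  assumes M: "locally_finite_matrix M A B" and v: "v \<in> finite_support B"
  shows "l2_inner u (mat_op (\<lambda>b a. M a b) B A v) = l2_inner (mat_op M A B u) v"
proof -
  define V where "V = {b. v b \<noteq> 0}"
  have V: "finite V" "V \<subseteq> B"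
    using v by (auto simp: V_def finite_support_def)
  \<comment> \<open>This finite set carries the transposed image of \<open>v\<close> and contains
    every coordinate of \<open>u\<close> that affects the image at a point of
    \<open>V\<close>.\<close>
  define S where "S = (\<Union>b\<in>V. {a \<in> A. M a b \<noteq> 0})"
  have S: "finite S" "S \<subseteq> A"
    using M V unfolding S_def locally_finite_matrix_def by auto
  have cobd: "mat_op (\<lambda>b a. M a b) B A v a = (\<Sum>b\<in>V. of_int (M a b) * v b)" if "a \<in> A" for a
    using V that by (intro mat_op_finite) (auto simp: V_def)
  have "{a. mat_op (\<lambda>b a. M a b) B A v a \<noteq> 0} \<subseteq> S"
  proof
    fix a assume "a \<in> {a. mat_op (\<lambda>b a. M a b) B A v a \<noteq> 0}"
    then have a: "a \<in> A" "mat_op (\<lambda>b a. M a b) B A v a \<noteq> 0"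
      by (auto simp: mat_op_def split: if_splits)
    then obtain b where "b \<in> V" "of_int (M a b) * v b \<noteq> 0"
      unfolding cobd [OF a(1)] by (meson sum.not_neutral_contains_not_neutral)
    with a(1) show "a \<in> S"
      unfolding S_def by auto
  qed
  then have "l2_inner u (mat_op (\<lambda>b a. M a b) B A v) = (\<Sum>a\<in>S. u a * cnj (\<Sum>b\<in>V. of_int (M a b) * v b))"
    using l2_inner_finite_support [OF S(1)] cobd S(2) by (simp add: subset_iff)
  also have "\<dots> = (\<Sum>a\<in>S. \<Sum>b\<in>V. of_int (M a b) * u a * cnj (v b))"
    by (simp add: sum_distrib_left mult_ac)
  also have "\<dots> = (\<Sum>b\<in>V. (\<Sum>a\<in>S. of_int (M a b) * u a) * cnj (v b))"
    by (subst sum.swap) (simp add: sum_distrib_right)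
  also have "\<dots> = (\<Sum>b\<in>V. mat_op M A B u b * cnj (v b))"
  proof (rule sum.cong)
    fix b assume "b \<in> V"
    then have "mat_op M A B u b = (\<Sum>a\<in>S. of_int (M a b) * u a)"
      using S V by (intro mat_op_finite) (auto simp: S_def)
    then show "(\<Sum>a\<in>S. of_int (M a b) * u a) * cnj (v b) = mat_op M A B u b * cnj (v b)"
      by simp
  qed simp
  also have "\<dots> = l2_inner (mat_op M A B u) v"
    using l2_inner_finite_support [OF V(1)] by (simp add: V_def)
  finally show ?thesis .
qed

text \<open>By adjointness, with basis vectors as test functions. It is applied to coboundaries to
  obtain the square-summable cycles, and to the transpose for the complement of the
  boundaries.\<close>

lemma mat_op_perp:
  assumes M: "locally_finite_matrix M A B"
  shows "l2_perp A (mat_op (\<lambda>b a. M a b) B A ` finite_support B) = {u \<in> l2 A. mat_op M A B u = (\<lambda>_. 0)}"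
proof -
  have "mat_op M A B u = (\<lambda>_. 0)" if u: "u \<in> l2_perp A (mat_op (\<lambda>b a. M a b) B A ` finite_support B)" for u
  proof
    fix b
    show "mat_op M A B u b = 0"
    proof (cases "b \<in> B")
      case True
      note b = finite_support_point [OF True]
      have "mat_op M A B u b = l2_inner u (mat_op (\<lambda>b a. M a b) B A (\<lambda>x. of_bool (x = b)))"
        unfolding mat_op_adjoint [OF M b] l2_inner_point ..
      then show ?thesis
        using u b unfolding l2_perp_def by simp
    qed (simp add: mat_op_def)
  qed
  then show ?thesis
    by (auto simp: l2_perp_def mat_op_adjoint [OF M])
qed

lemma l2_subspace_mat_op_image:
  assumes M: "locally_finite_matrix M A B"
  shows "l2_subspace B (mat_op M A B ` finite_support A)"
proof -
  note S = l2_subspace_finite_support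
  have "mat_op M A B ` finite_support A \<subseteq> l2 B"
    using mat_op_finite_support [OF M] l2_subspaceD(1) [OF S] by blast
  moreover have "(\<lambda>_. 0) \<in> mat_op M A B ` finite_support A"
    using mat_op_zero l2_subspaceD(3) [OF S] by (rule image_eqI [OF sym])
  ultimately show ?thesis
    unfolding l2_subspace_def
    by (auto simp: mat_op_add [OF M, symmetric] mat_op_scale [symmetric] intro!: imageI l2_subspaceD(4,5) [OF S])
qed

lemma l2_subspace_mat_op_kernel:
  assumes M: "locally_finite_matrix M A B"
  shows "l2_subspace A {u \<in> finite_support A. mat_op M A B u = (\<lambda>_. 0)}"
  using l2_subspace_finite_support [of A]
  unfolding l2_subspace_def
  by (auto simp: mat_op_add [OF M] mat_op_scale mat_op_zero)

text \<open>Every component of the image depends only on finitely many components of the argument,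
  so that a bound on finitely supported functions extends to all of \<open>\<ell>\<^sup>2\<close>.\<close>

lemma mat_op_bounded:
  assumes M: "locally_finite_matrix M A B" and C: "C \<ge> 0"
    and bound: "\<forall>u\<in>finite_support A. l2_norm (mat_op M A B u) \<le> C * l2_norm u"
    and u: "u \<in> l2 A"
  shows "mat_op M A B u \<in> l2 B" "l2_norm (mat_op M A B u) \<le> C * l2_norm u"
proof -
  have sums: "(\<Sum>b\<in>F. (cmod (mat_op M A B u b))\<^sup>2) \<le> (C * l2_norm u)\<^sup>2" if F: "finite F" for F
  proof -
    define S where "S = (\<Union>b\<in>F \<inter> B. {a \<in> A. M a b \<noteq> 0})"
    have S: "finite S"
      using M F unfolding S_def locally_finite_matrix_def by auto
    define w where "w a = (if a \<in> S then u a else 0)" for a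
    have w: "w \<in> finite_support A"
      by (rule finite_supportI [OF S]) (auto simp: w_def S_def)
    have "mat_op M A B u b = mat_op M A B w b" if "b \<in> F" for b
    proof (cases "b \<in> B")
      case True
      show ?thesis
        unfolding mat_op_column [OF M True] using that True by (intro sum.cong) (auto simp: w_def S_def)
    qed (simp add: mat_op_def)
    then have "(\<Sum>b\<in>F. (cmod (mat_op M A B u b))\<^sup>2) = (\<Sum>b\<in>F. (cmod (mat_op M A B w b))\<^sup>2)"
      by simp
    also have "\<dots> \<le> (l2_norm (mat_op M A B w))\<^sup>2"
      using l2_subspaceD(2) [OF l2_subspace_finite_support mat_op_finite_support [OF M w]] F
      by (rule l2_sum_le_norm_square)
    also have "\<dots> \<le> (C * l2_norm w)\<^sup>2"
      using bspec [OF bound w] by (intro power_mono) auto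
    also have "\<dots> \<le> (C * l2_norm u)\<^sup>2"
    proof -
      have "(l2_norm w)\<^sup>2 = (\<Sum>\<^sub>\<infinity>a\<in>S. (cmod (u a))\<^sup>2)"
        unfolding l2_norm_square by (intro infsum_cong_neutral) (auto simp: w_def)
      also have "\<dots> \<le> (l2_norm u)\<^sup>2"
        using l2_sum_le_norm_square [OF l2_imp_UNIV [OF u] S] S by simp
      finally show ?thesis
        by (simp add: power_mult_distrib mult_left_mono)
    qed
    finally show ?thesis .
  qed
  have zero: "mat_op M A B u b = 0" if "b \<notin> B" for b
    using that by (simp add: mat_op_def)
  show "mat_op M A B u \<in> l2 B"
    by (rule l2_of_bounded_sums(1) [OF zero sums])
  have "(l2_norm (mat_op M A B u))\<^sup>2 \<le> (C * l2_norm u)\<^sup>2"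
    by (rule l2_of_bounded_sums(2) [OF zero sums])
  then show "l2_norm (mat_op M A B u) \<le> C * l2_norm u"
    by (rule power2_le_imp_le) (use C in simp)
qed

text \<open>Finitely supported functions are dense and the operator is continuous.\<close>

lemma l2_closure_mat_op_image:
  assumes M: "locally_finite_matrix M A B" and C: "C \<ge> 0"
    and bound: "\<forall>u\<in>finite_support A. l2_norm (mat_op M A B u) \<le> C * l2_norm u"
  shows "l2_closure B (mat_op M A B ` l2 A) = l2_closure B (mat_op M A B ` finite_support A)"
proof
  note bounded = mat_op_bounded [OF M C bound]
  have sub: "finite_support A \<subseteq> l2 A"
    by (rule finite_support_subset_l2)
  show "l2_closure B (mat_op M A B ` finite_support A) \<subseteq> l2_closure B (mat_op M A B ` l2 A)"
    using sub by (intro l2_closure_mono image_mono)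
  have "mat_op M A B u \<in> l2_closure B (mat_op M A B ` finite_support A)" if u: "u \<in> l2 A" for u
  proof -
    have "\<exists>s\<in>mat_op M A B ` finite_support A. l2_norm (\<lambda>x. mat_op M A B u x - s x) < \<epsilon>"
      if e: "\<epsilon> > 0" for \<epsilon>
    proof -
      have "u \<in> l2_closure A (finite_support A)"
        unfolding l2_closure_finite_support by (rule u)
      moreover have "\<epsilon> / (C + 1) > 0"
        using e C by simp
      ultimately obtain s where s: "s \<in> finite_support A" "l2_norm (\<lambda>x. u x - s x) < \<epsilon> / (C + 1)"
        by (rule l2_closureE)
      have "l2_norm (\<lambda>x. mat_op M A B u x - mat_op M A B s x) \<le> C * l2_norm (\<lambda>x. u x - s x)"
        unfolding mat_op_diff [OF M, symmetric] using s sub u by (intro bounded l2_diff) auto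
      also have "\<dots> \<le> (C + 1) * l2_norm (\<lambda>x. u x - s x)"
        by (intro mult_right_mono) auto
      also have "\<dots> < \<epsilon>"
        using s(2) C by (simp add: pos_less_divide_eq mult.commute)
      finally show ?thesis
        using s(1) by blast
    qed
    then show ?thesis
      using bounded(1) [OF u] unfolding l2_closure_def by blast
  qed
  then have "l2_closure B (mat_op M A B ` l2 A) \<subseteq>
      l2_closure B (l2_closure B (mat_op M A B ` finite_support A))"
    by (intro l2_closure_mono) blast
  also have "\<dots> = l2_closure B (mat_op M A B ` finite_support A)"
    using l2_subspace_mat_op_image [OF M] by (intro l2_closure_idem) (simp add: l2_subspace_def)
  finally show "l2_closure B (mat_op M A B ` l2 A) \<subseteq> l2_closure B (mat_op M A B ` finite_support A)" .
qed

lemma finite_of_bounded_card: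
  assumes "\<And>F. finite F \<Longrightarrow> F \<subseteq> S \<Longrightarrow> real (card F) \<le> C"
  shows "finite S"
proof (rule ccontr)
  assume "infinite S"
  then obtain F where F: "F \<subseteq> S" "finite F" "card F = Suc (nat \<lceil>C\<rceil>)"
    using infinite_arbitrarily_large by blast
  then have "real (Suc (nat \<lceil>C\<rceil>)) \<le> C"
    using assms by metis
  then show False
    by linarith
qed

text \<open>The entries being integers, a square-summable row has only finitely many nonzero entries.\<close>

lemma finite_column_of_bounded:
  assumes cols: "\<And>a. a \<in> A \<Longrightarrow> finite {b \<in> B. M a b \<noteq> 0}" and b: "b \<in> B"
    and bound: "\<forall>u\<in>finite_support A. l2_norm (mat_op M A B u) \<le> C * l2_norm u"
  shows "finite {a \<in> A. M a b \<noteq> 0}"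
proof (rule finite_of_bounded_card [where C = "C\<^sup>2"])
  fix F assume F: "finite F" "F \<subseteq> {a \<in> A. M a b \<noteq> 0}"
  \<comment> \<open>Testing on the entries at \<open>b\<close> themselves makes the value at
    \<open>b\<close> equal to the squared norm \<open>s\<close> of \<open>u\<close>. Boundedness
    gives \<open>s \<le> C * sqrt s\<close>, so \<open>s \<le> C\<^sup>2\<close>, while each nonzero
    integer contributes at least 1 to \<open>s\<close>.\<close>
  define u where "u a = (if a \<in> F then complex_of_int (M a b) else 0)" for a
  define s where "s = (\<Sum>a\<in>F. (real_of_int (M a b))\<^sup>2)"
  have u: "u \<in> finite_support A"
    using F by (intro finite_supportI [of F]) (auto simp: u_def)
  have card: "real (card F) \<le> s"
  proof -
    have "1 \<le> (real_of_int (M a b))\<^sup>2" if "a \<in> F" for a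
    proof -
      have "1 \<le> \<bar>M a b\<bar>"
        using that F by auto
      then have "1 \<le> (M a b)\<^sup>2"
        by (metis one_le_power power2_abs)
      then show ?thesis
        by (metis of_int_1_le_iff of_int_power)
    qed
    then have "(\<Sum>a\<in>F. 1) \<le> s"
      unfolding s_def by (intro sum_mono)
    then show ?thesis by simp
  qed
  have norm_u: "(l2_norm u)\<^sup>2 = s"
  proof -
    have "(l2_norm u)\<^sup>2 = (\<Sum>\<^sub>\<infinity>a\<in>F. (real_of_int (M a b))\<^sup>2)"
      unfolding l2_norm_square by (intro infsum_cong_neutral) (auto simp: u_def)
    then show ?thesis
      using F by (simp add: s_def)
  qed
  \<comment> \<open>Square-summability of the image must be established first:
    \<open>l2_norm\<close> of a function that is not square-summable is 0 and would not dominate its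
    components.\<close>
  have "finite {b. mat_op M A B u b \<noteq> 0}"
  proof (rule finite_subset)
    show "{b. mat_op M A B u b \<noteq> 0} \<subseteq> (\<Union>a\<in>F. {b \<in> B. M a b \<noteq> 0})"
    proof
      fix c assume "c \<in> {b. mat_op M A B u b \<noteq> 0}"
      then have c: "c \<in> B" "mat_op M A B u c \<noteq> 0"
        by (auto simp: mat_op_def split: if_splits)
      moreover have "mat_op M A B u c = (\<Sum>a\<in>F. of_int (M a c) * u a)"
        using F c(1) by (intro mat_op_finite) (auto simp: u_def)
      ultimately obtain a where "a \<in> F" "of_int (M a c) * u a \<noteq> 0"
        by (metis (no_types, lifting) sum.not_neutral_contains_not_neutral)
      then show "c \<in> (\<Union>a\<in>F. {b \<in> B. M a b \<noteq> 0})"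
        using c(1) by auto
    qed
    show "finite (\<Union>a\<in>F. {b \<in> B. M a b \<noteq> 0})"
      using F cols by auto
  qed
  then have l2: "mat_op M A B u \<in> l2 UNIV"
    by (rule l2_of_finite_support) simp
  have "mat_op M A B u b = (\<Sum>a\<in>F. of_int (M a b) * u a)"
    using F b by (intro mat_op_finite) (auto simp: u_def)
  also have "\<dots> = complex_of_real s"
    by (simp add: u_def s_def power2_eq_square)
  finally have eq: "mat_op M A B u b = complex_of_real s" .
  have "s \<ge> 0"
    by (simp add: s_def sum_nonneg)
  then have "s \<le> l2_norm (mat_op M A B u)"
    using l2_norm_ge_component [OF l2, of b] unfolding eq norm_of_real by simp
  then have "s \<le> C * l2_norm u"
    using bspec [OF bound u] by linarith
  then have "s\<^sup>2 \<le> C\<^sup>2 * s"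
    using power_mono [of s "C * l2_norm u" 2] norm_u by (simp add: power_mult_distrib s_def sum_nonneg)
  then have "s \<le> C\<^sup>2"
    by (cases "s = 0") (auto simp: power2_eq_square s_def sum_nonneg order_less_le)
  then show "real (card F) \<le> C\<^sup>2"
    using card by linarith
qed

section \<open>Chains and cochains\<close>

lemma fin_chains_eq: "fin_chains X k = finite_support (cw_cells X k)"
  by (simp add: fin_chains_def finite_support_def)

lemma bd_Suc_eq: "bd X n (Suc k) = mat_op (n k) (cw_cells X (Suc k)) (cw_cells X k)"
  by (simp add: fun_eq_iff mat_op_def)

lemma cobd_eq: "cobd X n k = mat_op (\<lambda>b a. n k a b) (cw_cells X k) (cw_cells X (Suc k))"
  by (simp add: fun_eq_iff cobd_def mat_op_def)

lemma bounded_degreeE: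
  assumes "bounded_degree X n"
  obtains C where "C \<ge> 0"
    "\<forall>u\<in>finite_support (cw_cells X (Suc k)).
       l2_norm (mat_op (n k) (cw_cells X (Suc k)) (cw_cells X k) u) \<le> C * l2_norm u"
proof -
  obtain C where C: "\<forall>u\<in>fin_chains X (Suc k). l2_norm (bd X n (Suc k) u) \<le> C * l2_norm u"
    using assms unfolding bounded_degree_def by blast
  \<comment> \<open>The given constant may be negative, for instance when there are no cells in this
    dimension.\<close>
  have "l2_norm (bd X n (Suc k) u) \<le> max C 0 * l2_norm u" if "u \<in> fin_chains X (Suc k)" for u
  proof -
    have "C * l2_norm u \<le> max C 0 * l2_norm u"
      by (intro mult_right_mono) auto
    then show ?thesis
      using C that by fastforce
  qed
  then show thesis
    using that [of "max C 0"] unfolding bd_Suc_eq fin_chains_eq by auto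
qed

text \<open>A cell has finitely many faces by the definition of incidence numbers; that it is a face
  of finitely many cells comes from boundedness and integrality.\<close>

lemma incidence_locally_finite:
  assumes "incidence_numbers X n" "bounded_degree X n"
  shows "locally_finite_matrix (n k) (cw_cells X (Suc k)) (cw_cells X k)"
proof -
  obtain C where C: "\<forall>u\<in>finite_support (cw_cells X (Suc k)).
       l2_norm (mat_op (n k) (cw_cells X (Suc k)) (cw_cells X k) u) \<le> C * l2_norm u"
    using bounded_degreeE [OF assms(2)] .
  have col: "finite {b \<in> cw_cells X k. n k a b \<noteq> 0}" if "a \<in> cw_cells X (Suc k)" for a
    using assms(1) [unfolded incidence_numbers_def, rule_format, OF that] by (rule conjunct1)
  have "finite {a \<in> cw_cells X (Suc k). n k a b \<noteq> 0}" if "b \<in> cw_cells X k" for b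
    by (rule finite_column_of_bounded [where C = C and B = "cw_cells X k"]) (use col that C in auto)
  with col show ?thesis
    unfolding locally_finite_matrix_def by simp
qed

lemma bd_bd:
  assumes cw: "cw_complex X" "cw_locally_finite X" and n: "incidence_numbers X n" and bdeg: "bounded_degree X n"
    and u: "u \<in> finite_support (cw_cells X (Suc (Suc k)))"
  shows "mat_op (n k) (cw_cells X (Suc k)) (cw_cells X k)
    (mat_op (n (Suc k)) (cw_cells X (Suc (Suc k))) (cw_cells X (Suc k)) u) = (\<lambda>_. 0)"
proof
  fix c
  let ?A = "cw_cells X (Suc (Suc k))" and ?B = "cw_cells X (Suc k)"
  define U where "U = {a. u a \<noteq> 0}"
  have U: "finite U" "U \<subseteq> ?A"
    using u by (auto simp: U_def finite_support_def)
  note fin = incidence_locally_finite [OF n bdeg]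
  show "mat_op (n k) ?B (cw_cells X k) (mat_op (n (Suc k)) ?A ?B u) c = 0"
  proof (cases "c \<in> cw_cells X k")
    case c: True
    define R where "R = {b \<in> ?B. n k b c \<noteq> 0}"
    have R: "finite R" "R \<subseteq> ?B"
      using fin [of k] c unfolding R_def locally_finite_matrix_def by auto
    have inner: "mat_op (n (Suc k)) ?A ?B u b = (\<Sum>a\<in>U. of_int (n (Suc k) a b) * u a)" if "b \<in> ?B" for b
      using U that by (intro mat_op_finite) (auto simp: U_def)
    have zero: "(\<Sum>b\<in>R. n (Suc k) a b * n k b c) = 0" if "a \<in> U" for a
    proof -
      have a: "a \<in> ?A"
        using that U by blast
      have "finite {b \<in> ?B. n (Suc k) a b \<noteq> 0}"
        using fin [of "Suc k"] a unfolding locally_finite_matrix_def by blast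
      \<comment> \<open>One sum runs over the cells incident to \<open>c\<close>, the other over
        those incident to \<open>a\<close>; the products vanish outside the intersection.\<close>
      then have "(\<Sum>b\<in>R. n (Suc k) a b * n k b c) =
          (\<Sum>b | b \<in> ?B \<and> n (Suc k) a b \<noteq> 0. n (Suc k) a b * n k b c)"
        using R by (intro sum.mono_neutral_cong) (auto simp: R_def)
      then show ?thesis
        using incidence_numbers_boundary_boundary [OF cw n a c] by simp
    qed
    have "mat_op (n k) ?B (cw_cells X k) (mat_op (n (Suc k)) ?A ?B u) c =
        (\<Sum>b\<in>R. of_int (n k b c) * mat_op (n (Suc k)) ?A ?B u b)"
      unfolding mat_op_column [OF fin c] R_def ..
    also have "\<dots> = (\<Sum>b\<in>R. \<Sum>a\<in>U. of_int (n (Suc k) a b * n k b c) * u a)"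
      using R by (intro sum.cong) (auto simp: inner sum_distrib_left mult_ac)
    also have "\<dots> = (\<Sum>a\<in>U. of_int (\<Sum>b\<in>R. n (Suc k) a b * n k b c) * u a)"
      by (subst sum.swap) (simp add: sum_distrib_right)
    also have "\<dots> = 0"
      using zero by simp
    finally show ?thesis .
  qed (simp add: mat_op_def)
qed

text \<open>Dual to \<open>bd_bd\<close>: two applications of adjointness move both coboundaries
  onto a basis vector.\<close>

lemma cobd_cobd:
  fixes X :: "('a, 'c) oriented_cw"
  assumes cw: "cw_complex X" "cw_locally_finite X" and n: "incidence_numbers X n" and bdeg: "bounded_degree X n"
    and v: "v \<in> finite_support (cw_cells X k)"
  shows "mat_op (\<lambda>b a. n (Suc k) a b) (cw_cells X (Suc k)) (cw_cells X (Suc (Suc k)))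
    (mat_op (\<lambda>b a. n k a b) (cw_cells X k) (cw_cells X (Suc k)) v) = (\<lambda>_. 0)"
proof
  fix a :: 'c
  let ?\<delta> = "\<lambda>x. of_bool (x = a) :: complex"
  note fin = incidence_locally_finite [OF n bdeg]
  let ?v' = "mat_op (\<lambda>b a. n k a b) (cw_cells X k) (cw_cells X (Suc k)) v"
  let ?v'' = "mat_op (\<lambda>b a. n (Suc k) a b) (cw_cells X (Suc k)) (cw_cells X (Suc (Suc k))) ?v'"
  show "?v'' a = 0"
  proof (cases "a \<in> cw_cells X (Suc (Suc k))")
    case True
    have v': "?v' \<in> finite_support (cw_cells X (Suc k))"
      by (rule mat_op_finite_support [OF locally_finite_matrix_transpose [OF fin] v])
    have "l2_inner ?\<delta> ?v'' = 0"
      unfolding mat_op_adjoint [OF fin v'] mat_op_adjoint [OF fin v]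
        bd_bd [OF cw n bdeg finite_support_point [OF True]] by simp
    then have "l2_inner ?v'' ?\<delta> = 0"
      using l2_inner_commute [of ?v'' ?\<delta>] by simp
    then show ?thesis
      by (simp add: l2_inner_point)
  qed (simp add: mat_op_def)
qed

text \<open>Every \<open>u\<close> lies in its own coset, so if \<open>B\<close> is the only coset,
  it contains all of \<open>Z\<close>.\<close>

lemma trivial_l2_quotient:
  assumes Z: "l2_subspace E Z" and B: "l2_subspace E B" and sub: "B \<subseteq> Z"
  shows "trivial_group (\<lparr>carrier = Z, mult = (\<lambda>u v x. u x + v x), one = (\<lambda>_. 0)\<rparr> Mod B) \<longleftrightarrow> Z = B"
proof -
  let ?G = "\<lparr>carrier = Z, mult = (\<lambda>u v x. u x + v x), one = (\<lambda>_. 0)\<rparr> :: ('a \<Rightarrow> complex) monoid"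
  have "comm_group ?G"
  proof (rule comm_groupI; simp)
    show "(\<lambda>x. u x + v x) \<in> Z" if "u \<in> Z" "v \<in> Z" for u v
      by (rule l2_subspaceD(4) [OF Z that])
    show "(\<lambda>_. 0) \<in> Z"
      by (rule l2_subspaceD(3) [OF Z])
    show "\<exists>v\<in>Z. (\<lambda>x. v x + u x) = (\<lambda>_. 0)" if "u \<in> Z" for u
      using l2_subspaceD(5) [OF Z that, of "-1"] by (intro bexI [of _ "\<lambda>x. (-1) * u x"]) auto
  qed (auto simp: add_ac)
  then interpret G: comm_group ?G .
  have inv: "inv\<^bsub>?G\<^esub> u = (\<lambda>x. - u x)" if "u \<in> Z" for u
    using l2_subspaceD(5) [OF Z that, of "-1"] that by (intro G.inv_equality) auto
  have subgroup: "subgroup B ?G"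
  proof
    show "inv\<^bsub>?G\<^esub> u \<in> B" if "u \<in> B" for u
      using inv [of u] l2_subspaceD(5) [OF B that, of "-1"] that sub by auto
  qed (use sub l2_subspaceD(3,4) [OF B] in auto)
  then interpret normal B ?G
    by (rule G.subgroup_imp_normal)
  have one: "\<one>\<^bsub>?G Mod B\<^esub> = B"
    by (simp add: FactGroup_def)
  have carrier: "carrier (?G Mod B) = (\<lambda>u. B #>\<^bsub>?G\<^esub> u) ` Z"
    by (simp add: carrier_FactGroup)
  show ?thesis
  proof
    assume "trivial_group (?G Mod B)"
    then have "B #>\<^bsub>?G\<^esub> u = B" if "u \<in> Z" for u
      using that unfolding trivial_group_def carrier one by blast
    moreover have "u \<in> B #>\<^bsub>?G\<^esub> u" if "u \<in> Z" for u
      using G.rcos_self [OF _ subgroup, of u] that by simp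
    ultimately show "Z = B"
      using sub by blast
  next
    assume "Z = B"
    then have "B #>\<^bsub>?G\<^esub> u = B" if "u \<in> Z" for u
      using G.coset_join2 [OF _ subgroup, of u] that by simp
    then have "carrier (?G Mod B) = {\<one>\<^bsub>?G Mod B\<^esub>}"
      unfolding carrier one using l2_subspaceD(3) [OF Z] by auto
    then show "trivial_group (?G Mod B)"
      using factorgroup_is_group by (simp add: trivial_group_def)
  qed
qed

text \<open>The measures enter through their defining property, which determines each of them by
  \<open>determinantal_measure_unique\<close>; the incidence numbers enter in the same
  manner.\<close>

theorem mainTheorem1:
  fixes X :: "('a, 'c) oriented_cw"
    and n :: "nat \<Rightarrow> 'c \<Rightarrow> 'c \<Rightarrow> int"
    and k :: nat
    and P_W P_F P'_W P'_F :: "'c set measure"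
  assumes "cw_complex X"
    and "infinite (all_cells X)"
    and "cw_locally_finite X"
    and "incidence_numbers X n"
    and "bounded_degree X n"
    and "lower_wired X n k P_W"
    and "lower_free X n k P_F"
    and "upper_wired X n k P'_W"
    and "upper_free X n k P'_F"
  shows "(P_W = P_F \<and> P_F = P'_W \<and> P'_W = P'_F) \<longleftrightarrow> trivial_group (l2_homology X n k)"
proof -
  define E where "E = cw_cells X k"
  define Z where "Z = l2_cycles X n k"
  define S where "S = fin_coboundaries X n k"
  define T where "T = fin_boundaries X n k"
  note fin = incidence_locally_finite [OF assms(4,5)]
  note fin' = locally_finite_matrix_transpose [OF fin]
  note bd_bd = bd_bd [OF assms(1,3-5)] and cobd_cobd = cobd_cobd [OF assms(1,3-5)]
  note defs = E_def fin_chains_eq cobd_eq bd_Suc_eq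
  have S: "l2_subspace E S" and perp_S: "l2_perp E S = Z" and S_sub: "S \<subseteq> fin_cocycles X n k"
    and T_sub: "T \<subseteq> fin_cycles X n k"
  proof -
    have "l2_subspace E S \<and> l2_perp E S = Z \<and> S \<subseteq> fin_cocycles X n k \<and> T \<subseteq> fin_cycles X n k"
    proof (cases k)
      \<comment> \<open>Degree 0 rests on the conventions: \<open>\<partial>\<close> vanishes, so
        every square-summable function is a cycle, and this is the complement of the zero space of
        coboundaries.\<close>
      case 0
      then show ?thesis
        using mat_op_finite_support [OF fin [of 0]]
        by (auto simp: S_def Z_def T_def defs l2_subspace_def l2_perp_def l2_cycles_def l2_zero
            fin_cocycles_def fin_cycles_def fin_boundaries_def mat_op_zero finite_support_def)
    next
      case (Suc j)
      then have S_eq: "S = mat_op (\<lambda>b a. n j a b) (cw_cells X j) E ` finite_support (cw_cells X j)"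
        by (simp add: S_def defs)
      have "l2_subspace E S"
        unfolding S_eq E_def Suc by (rule l2_subspace_mat_op_image [OF fin'])
      moreover have "l2_perp E S = Z"
        unfolding S_eq Z_def l2_cycles_def defs Suc by (rule mat_op_perp [OF fin])
      moreover have "S \<subseteq> fin_cocycles X n k"
        unfolding S_eq fin_cocycles_def defs Suc
        using cobd_cobd mat_op_finite_support [OF fin'] by blast
      moreover have "T \<subseteq> fin_cycles X n k"
        unfolding T_def fin_cycles_def fin_boundaries_def defs Suc
        using bd_bd mat_op_finite_support [OF fin] by blast
      ultimately show ?thesis by blast
    qed
    then show "l2_subspace E S" "l2_perp E S = Z" "S \<subseteq> fin_cocycles X n k" "T \<subseteq> fin_cycles X n k"
      by blast+
  qed
  have T_eq: "T = mat_op (n k) (cw_cells X (Suc k)) E ` finite_support (cw_cells X (Suc k))"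
    by (simp add: T_def fin_boundaries_def defs)
  have T: "l2_subspace E T"
    unfolding T_eq E_def by (rule l2_subspace_mat_op_image [OF fin])
  \<comment> \<open>Here the finitely supported boundaries, which define the measure, replace the
    square-summable ones, which define homology.\<close>
  have cl_T: "l2_closure E (l2_boundaries X n k) = l2_closure E T"
  proof -
    obtain C where "C \<ge> 0" "\<forall>u\<in>finite_support (cw_cells X (Suc k)).
        l2_norm (mat_op (n k) (cw_cells X (Suc k)) (cw_cells X k) u) \<le> C * l2_norm u"
      using bounded_degreeE [OF assms(5)] .
    then show ?thesis
      unfolding T_eq l2_boundaries_def defs by (rule l2_closure_mat_op_image [OF fin])
  qed
  have perp_T: "l2_perp E T = {u \<in> l2 E. mat_op (\<lambda>b a. n k a b) E (cw_cells X (Suc k)) u = (\<lambda>_. 0)}"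
    unfolding T_eq E_def by (rule mat_op_perp [OF fin'])
  have cocycles: "l2_subspace E (fin_cocycles X n k)"
    unfolding fin_cocycles_def defs by (rule l2_subspace_mat_op_kernel [OF fin'])
  have cycles_Z: "fin_cycles X n k \<subseteq> Z"
    unfolding fin_cycles_def Z_def l2_cycles_def fin_chains_eq using finite_support_subset_l2 by blast
  have sub: "S \<subseteq> l2 E" "T \<subseteq> l2 E" "fin_cocycles X n k \<subseteq> l2 E" "fin_cycles X n k \<subseteq> l2 E"
    using S T cocycles cycles_Z l2_perp_subset [of E S] unfolding perp_S l2_subspace_def by auto
  define H1 where "H1 = l2_closure E S"
  define H2 where "H2 = l2_perp E (fin_cycles X n k)"
  define H3 where "H3 = l2_closure E (fin_cocycles X n k)"
  define H4 where "H4 = l2_perp E T"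
  have closed: "closed_l2_subspace E H1" "closed_l2_subspace E H2" "closed_l2_subspace E H3" "closed_l2_subspace E H4"
    unfolding closed_l2_subspace_def H1_def H2_def H3_def H4_def
    using sub S cocycles by (simp_all add: l2_subspace_closure l2_subspace_perp l2_closure_idem l2_closure_perp)
  have H1_eq: "H1 = l2_perp E Z"
    unfolding H1_def l2_perp_perp [OF S, symmetric] perp_S ..
  have H12: "H1 \<subseteq> H2"
    unfolding H1_eq H2_def by (rule l2_perp_antimono [OF cycles_Z])
  have H13: "H1 \<subseteq> H3"
    unfolding H1_def H3_def by (rule l2_closure_mono [OF S_sub])
  have H24: "H2 \<subseteq> H4"
    unfolding H2_def H4_def by (rule l2_perp_antimono [OF T_sub])
  have "fin_cocycles X n k \<subseteq> H4"
    unfolding H4_def perp_T unfolding fin_cocycles_def defs using finite_support_subset_l2 by blast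
  then have H34: "H3 \<subseteq> H4"
    using l2_closure_mono l2_closure_perp [OF sub(2)] unfolding H3_def H4_def by blast
  have measures: "determinantal_measure E H1 P_W" "determinantal_measure E H2 P_F"
    "determinantal_measure E H3 P'_W" "determinantal_measure E H4 P'_F"
    using assms(6-9)
    by (simp_all add: lower_wired_def lower_free_def upper_wired_def upper_free_def
        H1_def H2_def H3_def H4_def S_def T_def E_def)
  have "P_W = P_F \<longleftrightarrow> H1 = H2" "P_W = P'_W \<longleftrightarrow> H1 = H3" "P_W = P'_F \<longleftrightarrow> H1 = H4"
    using determinantal_measure_eq_iff [OF closed(1,2) H12 measures(1,2)]
      determinantal_measure_eq_iff [OF closed(1,3) H13 measures(1,3)]
      determinantal_measure_eq_iff [OF closed(1,4) order_trans [OF H12 H24] measures(1,4)] .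
  \<comment> \<open>If the extreme subspaces agree, both intermediate ones are squeezed to the same
    subspace.\<close>
  then have "(P_W = P_F \<and> P_F = P'_W \<and> P'_W = P'_F) \<longleftrightarrow> H1 = H4"
    using H12 H13 H24 H34 by auto
  also have "\<dots> \<longleftrightarrow> Z = l2_closure E T"
  proof
    assume "H1 = H4"
    then have "l2_perp E H1 = l2_perp E H4"
      by simp
    then show "Z = l2_closure E T"
      unfolding H1_def H4_def l2_perp_closure [OF S] l2_perp_perp [OF T] perp_S .
  next
    assume "Z = l2_closure E T"
    then show "H1 = H4"
      unfolding H1_eq H4_def by (simp add: l2_perp_closure [OF T])
  qed
  also have "\<dots> \<longleftrightarrow> trivial_group (l2_homology X n k)"
  proof -
    have "l2_subspace E Z"
      unfolding perp_S [symmetric] by (rule l2_subspace_perp [OF sub(1)])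
    moreover have "l2_closure E T \<subseteq> Z"
      using l2_closure_mono [OF order_trans [OF T_sub cycles_Z]] l2_closure_perp [OF sub(1)]
      unfolding perp_S by blast
    ultimately show ?thesis
      unfolding l2_homology_def Z_def [symmetric] E_def [symmetric] cl_T
      using trivial_l2_quotient [OF _ l2_subspace_closure [OF T]] by blast
  qed
  finally show ?thesis .
qed

end
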